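(* Let $(M,\varphi,\xi,\eta,g)$ be a $(2n+1)$-dimensional almost contact B-metric manifold from the class $\mathcal{F}_1\oplus\mathcal{F}_4\oplus\mathcal{F}_5\oplus\mathcal{F}_{11}$. Consider the family of natural connections on $M$ with torsion $$T(x,y,z)=(\pi_3+\pi_5)(x,y,z,q)+\frac{1}{2n}(\pi_2+\pi_4)(x,y,z,a^* )+\frac{1}{2n}\pi_5(x,y,z,a)-\pi_5(x,y,z,\hat a),$$ where $q=\alpha_1\varphi^2a^*-\alpha_2\varphi^2a-\alpha_3\varphi\hat a+\alpha_4\hat a$ and $\alpha_1,\alpha_2,\alpha_3,\alpha_4\in\mathbb{R}$. The natural connection with torsion $T$ from this family is the $\varphi$-canonical connection on $M$ if and only if $\alpha_1=\alpha_3=\alpha_4=0$ and $\alpha_2=\frac{1}{4n}$. Then its torsion has the form $$T^0(x,y,z)=\frac{1}{4n}(\pi_1+\pi_2+\pi_4)(x,y,z,a^* )+\frac{1}{2n}\pi_5(x,y,z,a)-\pi_5(x,y,z,\hat a).$$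
   Context: An almost contact B-metric manifold $(M,\varphi,\xi,\eta,g)$ is a $(2n+1)$-dimensional differentiable manifold with an endomorphism $\varphi$ of the tangent bundle, a vector field $\xi$, its dual 1-form $\eta$ and a pseudo-Riemannian metric $g$ of signature $(n,n+1)$ such that $\varphi\xi=0$, $\varphi^2=-\mathrm{Id}+\eta\otimes\xi$, $\eta\circ\varphi=0$, $\eta(\xi)=1$ and $g(x,y)=-g(\varphi x,\varphi y)+\eta(x)\eta(y)$. Below $x,y,z,w$ are arbitrary vector fields. Let $\nabla$ be the Levi-Civita connection of $g$ and $F(x,y,z)=g((\nabla_x\varphi)y,z)$. Define the 1-forms $\theta(z)=g^{ij}F(e_i,e_j,z)$, $\theta^*(z)=g^{ij}F(e_i,\varphi e_j,z)$, $\omega(z)=F(\xi,\xi,z)$, where $\{e_i;\xi\}$ $(i=1,\dots,2n)$ is a basis of $T_pM$ with $e_i\in\ker\eta$ and $g^{ij}$ are the components of the inverse matrix of $g$. The vector fields $a,a^*,\hat a$ are defined by $\theta=g(\cdot,a)$, $\theta^*=g(\cdot,a^* )$, $\omega=g(\cdot,\hat a)$. $M$ belongs to the class $\mathcal{F}_1\oplus\mathcal{F}_4\oplus\mathcal{F}_5\oplus\mathcal{F}_{11}$ if $$F(x,y,z)=-\tfrac{1}{2n}\bigl\{g(\varphi x,\varphi y)\theta(z)+g(x,\varphi y)\theta^*(z)-2n\,\eta(x)\eta(y)\omega(z)+g(\varphi x,\varphi z)\theta(y)+g(x,\varphi z)\theta^*(y)-2n\,\eta(x)\eta(z)\omega(y)\bigr\}.$$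 A linear connection $D$ is natural if $D\varphi=D\xi=D\eta=Dg=0$. Its torsion is $T(x,y)=D_xy-D_yx-[x,y]$, and $T(x,y,z)=g(T(x,y),z)$. For a tensor $A$ and two of its arguments $u,v$, $\{A\}_{[u\leftrightarrow v]}$ denotes $A$ minus the expression obtained by interchanging $u$ and $v$. A natural connection is called $\varphi$-canonical if its torsion satisfies $$\bigl\{T(x,y,z)-T(x,\varphi y,\varphi z)-\eta(x)\{T(\xi,y,z)-T(\xi,\varphi y,\varphi z)\}-\eta(y)\{T(x,\xi,z)-T(x,z,\xi)-\eta(x)T(z,\xi,\xi)\}\bigr\}_{[y\leftrightarrow z]}=0.$$ It is known that on manifolds in the class considered the torsion of the $\varphi$-canonical connection is $T^0(x,y,z)=\frac12\{F(x,\varphi y,z)+\eta(z)F(x,\varphi y,\xi)+2\eta(x)F(y,\varphi z,\xi)\}_{[x\leftrightarrow y]}$. Define $\pi_1(x,y)z=\{g(y,z)x\}_{[x\leftrightarrow y]}$, $\pi_2(x,y)z=\{g(y,\varphi z)\varphi x\}_{[x\leftrightarrow y]}$, $\pi_3(x,y)z=-\{g(y,z)\varphi x+g(y,\varphi z)x\}_{[x\leftrightarrow y]}$, $\pi_4(x,y)z=\{\eta(y)\eta(z)x+g(y,z)\eta(x)\xi\}_{[x\leftrightarrow y]}$, $\pi_5(x,y)z=\{\eta(y)\eta(z)\varphi x+g(y,\varphi z)\eta(x)\xi\}_{[x\leftrightarrow y]}$, and $\pi_i(x,y,z,w)=g(\pi_i(x,y)z,w)$.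
   Formalization: The "only if" on the parameters is stated for n ≥ 2 and φ²a*, φ²a, φâ, â linearly independent over ℝ; otherwise different parameters give the same torsion (e.g. F = 0, or n = 1) and it fails. In general the connection is φ-canonical iff its torsion is the one for these parameters. *)

theory Defs
  imports "HOL-Analysis.Analysis" "HOL-Library.Function_Algebras"
begin

section \<open>Smooth manifolds\<close>

text \<open>Class \<open>C\<^sup>k\<close> on an open subset of a Euclidean space, through iterated directional derivatives.\<close>

primrec Ck_on :: "nat \<Rightarrow> 'a::euclidean_space set \<Rightarrow> ('a \<Rightarrow> 'b::real_normed_vector) \<Rightarrow> bool" where
  "Ck_on 0 S f \<longleftrightarrow> continuous_on S f"
| "Ck_on (Suc k) S f \<longleftrightarrow>
     (\<forall>x\<in>S. f differentiable (at x)) \<and> (\<forall>v. Ck_on k S (\<lambda>x. frechet_derivative f (at x) v))"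

definition smooth_on :: "'a::euclidean_space set \<Rightarrow> ('a \<Rightarrow> 'b::real_normed_vector) \<Rightarrow> bool" where
  "smooth_on S f \<longleftrightarrow> (\<forall>k. Ck_on k S f)"

text \<open>The manifold is the whole of a Hausdorff, second countable type \<open>'m\<close>; a chart is a pair of an
  open domain and a coordinate map into the Euclidean space \<open>'e\<close>. The atlas need not be maximal.\<close>

type_synonym ('m, 'e) chart = "'m set \<times> ('m \<Rightarrow> 'e)"

definition smooth_atlas ::
    "('m::{t2_space,second_countable_topology}, 'e::euclidean_space) chart set \<Rightarrow> bool" where
  "smooth_atlas A \<longleftrightarrow>
     (\<Union>(U, \<kappa>)\<in>A. U) = UNIV \<and>
     (\<forall>(U, \<kappa>)\<in>A. open U \<and> open (\<kappa> ` U) \<and> homeomorphism U (\<kappa> ` U) \<kappa> (inv_into U \<kappa>)) \<and>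
     (\<forall>(U, \<kappa>)\<in>A. \<forall>(V, \<mu>)\<in>A. smooth_on (\<kappa> ` (U \<inter> V)) (\<mu> \<circ> inv_into U \<kappa>))"

definition smooth_funs :: "('m, 'e::euclidean_space) chart set \<Rightarrow> ('m \<Rightarrow> real) set" where
  "smooth_funs A = {f. \<forall>(U, \<kappa>)\<in>A. smooth_on (\<kappa> ` U) (f \<circ> inv_into U \<kappa>)}"

text \<open>Vector fields are the derivations of the algebra of smooth functions, and tangent vectors at
  \<open>p\<close> are its derivations at \<open>p\<close>. Both are fixed to be 0 on non-smooth functions, so that
  equality of HOL functions is equality of derivations. The value at \<open>p\<close> of a vector field \<open>X\<close> is
  \<open>\<lambda>f. X f p\<close>. Sums and products of functions are pointwise (Function_Algebras).\<close>

type_synonym 'm vfield = "('m \<Rightarrow> real) \<Rightarrow> 'm \<Rightarrow> real"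

definition vfields :: "('m, 'e::euclidean_space) chart set \<Rightarrow> 'm vfield set" where
  "vfields A = {X.
     (\<forall>f\<in>smooth_funs A. X f \<in> smooth_funs A) \<and>
     (\<forall>f. f \<notin> smooth_funs A \<longrightarrow> X f = 0) \<and>
     (\<forall>f\<in>smooth_funs A. \<forall>h\<in>smooth_funs A. \<forall>c d.
        X ((\<lambda>_. c) * f + (\<lambda>_. d) * h) = (\<lambda>_. c) * X f + (\<lambda>_. d) * X h) \<and>
     (\<forall>f\<in>smooth_funs A. \<forall>h\<in>smooth_funs A. X (f * h) = f * X h + h * X f)}"

definition tangent_space ::
    "('m, 'e::euclidean_space) chart set \<Rightarrow> 'm \<Rightarrow> (('m \<Rightarrow> real) \<Rightarrow> real) set" where
  "tangent_space A p = {v.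
     (\<forall>f. f \<notin> smooth_funs A \<longrightarrow> v f = 0) \<and>
     (\<forall>f\<in>smooth_funs A. \<forall>h\<in>smooth_funs A. \<forall>c d.
        v ((\<lambda>_. c) * f + (\<lambda>_. d) * h) = c * v f + d * v h) \<and>
     (\<forall>f\<in>smooth_funs A. \<forall>h\<in>smooth_funs A. v (f * h) = f p * v h + h p * v f)}"

definition fmult :: "('m \<Rightarrow> real) \<Rightarrow> 'm vfield \<Rightarrow> 'm vfield" (infixr "\<cdot>" 75) where
  "f \<cdot> X = (\<lambda>h. f * X h)"

definition lie :: "'m vfield \<Rightarrow> 'm vfield \<Rightarrow> 'm vfield" where
  "lie X Y = (\<lambda>f. X (Y f) - Y (X f))"

text \<open>The values at \<open>p\<close> of the vector fields \<open>e 0, \<dots>, e (N - 1)\<close> form a basis of the tangent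
  space at \<open>p\<close>.\<close>

definition frame_at ::
    "('m, 'e::euclidean_space) chart set \<Rightarrow> 'm \<Rightarrow> nat \<Rightarrow> (nat \<Rightarrow> 'm vfield) \<Rightarrow> bool" where
  "frame_at A p N e \<longleftrightarrow>
     (\<forall>i<N. e i \<in> vfields A) \<and>
     (\<forall>c. (\<forall>f. (\<Sum>i<N. c i * e i f p) = 0) \<longrightarrow> (\<forall>i<N. c i = 0)) \<and>
     (\<forall>v\<in>tangent_space A p. \<exists>c. \<forall>f. v f = (\<Sum>i<N. c i * e i f p))"

section \<open>Tensor fields and linear connections\<close>

text \<open>Tensor fields are maps on vector fields that are linear over the smooth functions; their
  values outside \<open>vfields A\<close> are irrelevant.\<close>

definition one_form :: "('m, 'e::euclidean_space) chart set \<Rightarrow> ('m vfield \<Rightarrow> 'm \<Rightarrow> real) \<Rightarrow> bool" where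
  "one_form A \<omega> \<longleftrightarrow>
     (\<forall>X\<in>vfields A. \<omega> X \<in> smooth_funs A) \<and>
     (\<forall>X\<in>vfields A. \<forall>Y\<in>vfields A. \<forall>f\<in>smooth_funs A. \<forall>h\<in>smooth_funs A.
        \<omega> (f \<cdot> X + h \<cdot> Y) = f * \<omega> X + h * \<omega> Y)"

definition endomorphism_field ::
    "('m, 'e::euclidean_space) chart set \<Rightarrow> ('m vfield \<Rightarrow> 'm vfield) \<Rightarrow> bool" where
  "endomorphism_field A \<phi> \<longleftrightarrow>
     (\<forall>X\<in>vfields A. \<phi> X \<in> vfields A) \<and>
     (\<forall>X\<in>vfields A. \<forall>Y\<in>vfields A. \<forall>f\<in>smooth_funs A. \<forall>h\<in>smooth_funs A.
        \<phi> (f \<cdot> X + h \<cdot> Y) = f \<cdot> \<phi> X + h \<cdot> \<phi> Y)"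

text \<open>Pseudo-Riemannian metric of constant signature \<open>(r, s)\<close>, where \<open>r\<close> counts the negative and
  \<open>s\<close> the positive squares. This order is forced for the signature \<open>(n, n + 1)\<close> of an almost contact
  B-metric manifold, since there \<open>g\<close> is neutral on the kernel of \<open>\<eta>\<close> and \<open>g(\<xi>, \<xi>) = 1\<close>.\<close>

definition pseudo_metric ::
    "('m, 'e::euclidean_space) chart set \<Rightarrow> nat \<Rightarrow> nat \<Rightarrow> ('m vfield \<Rightarrow> 'm vfield \<Rightarrow> 'm \<Rightarrow> real) \<Rightarrow> bool" where
  "pseudo_metric A r s g \<longleftrightarrow>
     (\<forall>X\<in>vfields A. one_form A (g X)) \<and>
     (\<forall>X\<in>vfields A. \<forall>Y\<in>vfields A. g X Y = g Y X) \<and>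
     (\<forall>p. \<exists>e. frame_at A p (r + s) e \<and>
        (\<forall>i<r + s. \<forall>j<r + s. g (e i) (e j) p = (if i \<noteq> j then 0 else if i < r then - 1 else 1)))"

definition linear_connection ::
    "('m, 'e::euclidean_space) chart set \<Rightarrow> ('m vfield \<Rightarrow> 'm vfield \<Rightarrow> 'm vfield) \<Rightarrow> bool" where
  "linear_connection A D \<longleftrightarrow>
     (\<forall>X\<in>vfields A. \<forall>Y\<in>vfields A. D X Y \<in> vfields A) \<and>
     (\<forall>X\<in>vfields A. \<forall>Y\<in>vfields A. \<forall>Z\<in>vfields A. \<forall>f\<in>smooth_funs A. \<forall>h\<in>smooth_funs A.
        D (f \<cdot> X + h \<cdot> Y) Z = f \<cdot> D X Z + h \<cdot> D Y Z) \<and>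
     (\<forall>X\<in>vfields A. \<forall>Y\<in>vfields A. \<forall>Z\<in>vfields A. D X (Y + Z) = D X Y + D X Z) \<and>
     (\<forall>X\<in>vfields A. \<forall>Y\<in>vfields A. \<forall>f\<in>smooth_funs A. D X (f \<cdot> Y) = f \<cdot> D X Y + X f \<cdot> Y)"

definition torsion :: "('m vfield \<Rightarrow> 'm vfield \<Rightarrow> 'm vfield) \<Rightarrow> 'm vfield \<Rightarrow> 'm vfield \<Rightarrow> 'm vfield" where
  "torsion D x y = D x y - D y x - lie x y"

definition parallel_metric ::
    "('m, 'e::euclidean_space) chart set \<Rightarrow> ('m vfield \<Rightarrow> 'm vfield \<Rightarrow> 'm vfield) \<Rightarrow>
     ('m vfield \<Rightarrow> 'm vfield \<Rightarrow> 'm \<Rightarrow> real) \<Rightarrow> bool" where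
  "parallel_metric A D g \<longleftrightarrow>
     (\<forall>x\<in>vfields A. \<forall>y\<in>vfields A. \<forall>z\<in>vfields A. x (g y z) - g (D x y) z - g y (D x z) = 0)"

definition levi_civita ::
    "('m, 'e::euclidean_space) chart set \<Rightarrow> ('m vfield \<Rightarrow> 'm vfield \<Rightarrow> 'm \<Rightarrow> real) \<Rightarrow>
     ('m vfield \<Rightarrow> 'm vfield \<Rightarrow> 'm vfield) \<Rightarrow> bool" where
  "levi_civita A g D \<longleftrightarrow>
     linear_connection A D \<and> parallel_metric A D g \<and>
     (\<forall>x\<in>vfields A. \<forall>y\<in>vfields A. torsion D x y = 0)"

section \<open>Almost contact B-metric manifolds\<close>

record ('m, 'e) acb_structure =
  charts :: "('m, 'e) chart set"
  phi :: "'m vfield \<Rightarrow> 'm vfield"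
  xi :: "'m vfield"
  eta :: "'m vfield \<Rightarrow> 'm \<Rightarrow> real"
  bmetric :: "'m vfield \<Rightarrow> 'm vfield \<Rightarrow> 'm \<Rightarrow> real"

abbreviation VF :: "('m, 'e::euclidean_space) acb_structure \<Rightarrow> 'm vfield set" where
  "VF M \<equiv> vfields (charts M)"

definition almost_contact_B_metric ::
    "nat \<Rightarrow> ('m::{t2_space,second_countable_topology}, 'e::euclidean_space) acb_structure \<Rightarrow> bool" where
  "almost_contact_B_metric n M \<longleftrightarrow>
     DIM('e) = 2 * n + 1 \<and>
     smooth_atlas (charts M) \<and>
     endomorphism_field (charts M) (phi M) \<and>
     xi M \<in> VF M \<and>
     one_form (charts M) (eta M) \<and>
     pseudo_metric (charts M) n (n + 1) (bmetric M) \<and>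
     phi M (xi M) = 0 \<and>
     (\<forall>x\<in>VF M. phi M (phi M x) = - x + eta M x \<cdot> xi M) \<and>
     (\<forall>x\<in>VF M. eta M (phi M x) = 0) \<and>
     eta M (xi M) = 1 \<and>
     (\<forall>x\<in>VF M. \<forall>y\<in>VF M. bmetric M x y = - bmetric M (phi M x) (phi M y) + eta M x * eta M y)"

text \<open>The argument \<open>D\<close> of \<open>F_tensor\<close> and of the notions built on it is the Levi-Civita connection.\<close>

definition F_tensor ::
    "('m, 'e::euclidean_space) acb_structure \<Rightarrow> ('m vfield \<Rightarrow> 'm vfield \<Rightarrow> 'm vfield) \<Rightarrow>
     'm vfield \<Rightarrow> 'm vfield \<Rightarrow> 'm vfield \<Rightarrow> 'm \<Rightarrow> real" where
  "F_tensor M D x y z = bmetric M (D x (phi M y) - phi M (D x y)) z"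

text \<open>Vector fields \<open>e 0, \<dots>, e (2n - 1)\<close> whose values at \<open>p\<close> lie in the kernel of \<open>\<eta>\<close> and form,
  together with the value of \<open>\<xi>\<close>, a basis of the tangent space at \<open>p\<close>.\<close>

definition adapted_basis ::
    "nat \<Rightarrow> ('m, 'e::euclidean_space) acb_structure \<Rightarrow> 'm \<Rightarrow> (nat \<Rightarrow> 'm vfield) \<Rightarrow> bool" where
  "adapted_basis n M p e \<longleftrightarrow>
     frame_at (charts M) p (2 * n + 1) (\<lambda>i. if i < 2 * n then e i else xi M) \<and>
     (\<forall>i<2 * n. eta M (e i) p = 0)"

text \<open>The matrix \<open>g\<^sup>i\<^sup>j\<close> at \<open>p\<close>. As \<open>\<xi>\<close> is orthogonal to the kernel of \<open>\<eta>\<close>, the block of the inverse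
  matrix with indices below \<open>2n\<close> is the inverse of the corresponding block of \<open>g\<close>. Only these entries
  are used, and they are determined uniquely.\<close>

definition inverse_metric ::
    "nat \<Rightarrow> ('m, 'e) acb_structure \<Rightarrow> 'm \<Rightarrow> (nat \<Rightarrow> 'm vfield) \<Rightarrow> nat \<Rightarrow> nat \<Rightarrow> real" where
  "inverse_metric n M p e = (SOME h. \<forall>i<2 * n. \<forall>k<2 * n.
     (\<Sum>j<2 * n. h i j * bmetric M (e j) (e k) p) = (if i = k then 1 else 0))"

text \<open>The traces \<open>\<theta>\<close> and \<open>\<theta>\<^sup>*\<close> do not depend on the basis that is chosen.\<close>

definition theta ::
    "nat \<Rightarrow> ('m, 'e::euclidean_space) acb_structure \<Rightarrow> ('m vfield \<Rightarrow> 'm vfield \<Rightarrow> 'm vfield) \<Rightarrow>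
     'm vfield \<Rightarrow> 'm \<Rightarrow> real" where
  "theta n M D z p = (let e = (SOME e. adapted_basis n M p e) in
     \<Sum>i<2 * n. \<Sum>j<2 * n. inverse_metric n M p e i j * F_tensor M D (e i) (e j) z p)"

definition theta_star ::
    "nat \<Rightarrow> ('m, 'e::euclidean_space) acb_structure \<Rightarrow> ('m vfield \<Rightarrow> 'm vfield \<Rightarrow> 'm vfield) \<Rightarrow>
     'm vfield \<Rightarrow> 'm \<Rightarrow> real" where
  "theta_star n M D z p = (let e = (SOME e. adapted_basis n M p e) in
     \<Sum>i<2 * n. \<Sum>j<2 * n. inverse_metric n M p e i j * F_tensor M D (e i) (phi M (e j)) z p)"

definition omega ::
    "('m, 'e::euclidean_space) acb_structure \<Rightarrow> ('m vfield \<Rightarrow> 'm vfield \<Rightarrow> 'm vfield) \<Rightarrow>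
     'm vfield \<Rightarrow> 'm \<Rightarrow> real" where
  "omega M D z = F_tensor M D (xi M) (xi M) z"

definition metric_dual ::
    "('m, 'e::euclidean_space) acb_structure \<Rightarrow> ('m vfield \<Rightarrow> 'm \<Rightarrow> real) \<Rightarrow> 'm vfield \<Rightarrow> bool" where
  "metric_dual M \<omega> a \<longleftrightarrow> a \<in> VF M \<and> (\<forall>x\<in>VF M. \<omega> x = bmetric M x a)"

definition class_F1_F4_F5_F11 ::
    "nat \<Rightarrow> ('m, 'e::euclidean_space) acb_structure \<Rightarrow> ('m vfield \<Rightarrow> 'm vfield \<Rightarrow> 'm vfield) \<Rightarrow> bool" where
  "class_F1_F4_F5_F11 n M D \<longleftrightarrow>
     (let g = bmetric M; \<phi> = phi M; \<eta> = eta M;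
          \<theta> = theta n M D; \<theta>s = theta_star n M D; \<omega> = omega M D
      in \<forall>x\<in>VF M. \<forall>y\<in>VF M. \<forall>z\<in>VF M.
        F_tensor M D x y z = (\<lambda>_. - (1 / (2 * real n))) *
          (g (\<phi> x) (\<phi> y) * \<theta> z + g x (\<phi> y) * \<theta>s z - (\<lambda>_. 2 * real n) * \<eta> x * \<eta> y * \<omega> z +
           g (\<phi> x) (\<phi> z) * \<theta> y + g x (\<phi> z) * \<theta>s y - (\<lambda>_. 2 * real n) * \<eta> x * \<eta> z * \<omega> y))"

definition natural_connection ::
    "('m, 'e::euclidean_space) acb_structure \<Rightarrow> ('m vfield \<Rightarrow> 'm vfield \<Rightarrow> 'm vfield) \<Rightarrow> bool" where
  "natural_connection M D \<longleftrightarrow>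
     linear_connection (charts M) D \<and>
     (\<forall>x\<in>VF M. \<forall>y\<in>VF M. D x (phi M y) - phi M (D x y) = 0) \<and>
     (\<forall>x\<in>VF M. D x (xi M) = 0) \<and>
     (\<forall>x\<in>VF M. \<forall>y\<in>VF M. x (eta M y) - eta M (D x y) = 0) \<and>
     parallel_metric (charts M) D (bmetric M)"

definition torsion3 ::
    "('m, 'e) acb_structure \<Rightarrow> ('m vfield \<Rightarrow> 'm vfield \<Rightarrow> 'm vfield) \<Rightarrow>
     'm vfield \<Rightarrow> 'm vfield \<Rightarrow> 'm vfield \<Rightarrow> 'm \<Rightarrow> real" where
  "torsion3 M D x y z = bmetric M (torsion D x y) z"

text \<open>The operation \<open>{A}\<^bsub>[u\<leftrightarrow>v]\<^esub>\<close>.\<close>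

definition swap_diff :: "('u \<Rightarrow> 'u \<Rightarrow> 'w::minus) \<Rightarrow> 'u \<Rightarrow> 'u \<Rightarrow> 'w" where
  "swap_diff A u v = A u v - A v u"

definition phi_canonical ::
    "('m, 'e::euclidean_space) acb_structure \<Rightarrow> ('m vfield \<Rightarrow> 'm vfield \<Rightarrow> 'm vfield) \<Rightarrow> bool" where
  "phi_canonical M D \<longleftrightarrow>
     natural_connection M D \<and>
     (let T = torsion3 M D; \<phi> = phi M; \<xi> = xi M; \<eta> = eta M
      in \<forall>x\<in>VF M. \<forall>y\<in>VF M. \<forall>z\<in>VF M.
        swap_diff (\<lambda>y z.
          T x y z - T x (\<phi> y) (\<phi> z)
          - \<eta> x * (T \<xi> y z - T \<xi> (\<phi> y) (\<phi> z))
          - \<eta> y * (T x \<xi> z - T x z \<xi> - \<eta> x * T z \<xi> \<xi>)) y z = 0)"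

definition pi1 :: "('m, 'e) acb_structure \<Rightarrow> 'm vfield \<Rightarrow> 'm vfield \<Rightarrow> 'm vfield \<Rightarrow> 'm vfield" where
  "pi1 M x y z = swap_diff (\<lambda>x y. bmetric M y z \<cdot> x) x y"

definition pi2 :: "('m, 'e) acb_structure \<Rightarrow> 'm vfield \<Rightarrow> 'm vfield \<Rightarrow> 'm vfield \<Rightarrow> 'm vfield" where
  "pi2 M x y z = swap_diff (\<lambda>x y. bmetric M y (phi M z) \<cdot> phi M x) x y"

definition pi3 :: "('m, 'e) acb_structure \<Rightarrow> 'm vfield \<Rightarrow> 'm vfield \<Rightarrow> 'm vfield \<Rightarrow> 'm vfield" where
  "pi3 M x y z = - swap_diff (\<lambda>x y. bmetric M y z \<cdot> phi M x + bmetric M y (phi M z) \<cdot> x) x y"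

definition pi4 :: "('m, 'e) acb_structure \<Rightarrow> 'm vfield \<Rightarrow> 'm vfield \<Rightarrow> 'm vfield \<Rightarrow> 'm vfield" where
  "pi4 M x y z = swap_diff (\<lambda>x y.
     (eta M y * eta M z) \<cdot> x + (bmetric M y z * eta M x) \<cdot> xi M) x y"

definition pi5 :: "('m, 'e) acb_structure \<Rightarrow> 'm vfield \<Rightarrow> 'm vfield \<Rightarrow> 'm vfield \<Rightarrow> 'm vfield" where
  "pi5 M x y z = swap_diff (\<lambda>x y.
     (eta M y * eta M z) \<cdot> phi M x + (bmetric M y (phi M z) * eta M x) \<cdot> xi M) x y"

definition lower ::
    "('m, 'e) acb_structure \<Rightarrow> ('m vfield \<Rightarrow> 'm vfield \<Rightarrow> 'm vfield \<Rightarrow> 'm vfield) \<Rightarrow>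
     'm vfield \<Rightarrow> 'm vfield \<Rightarrow> 'm vfield \<Rightarrow> 'm vfield \<Rightarrow> 'm \<Rightarrow> real" where
  "lower M P x y z w = bmetric M (P x y z) w"

definition q_field ::
    "('m, 'e) acb_structure \<Rightarrow> 'm vfield \<Rightarrow> 'm vfield \<Rightarrow> 'm vfield \<Rightarrow>
     real \<Rightarrow> real \<Rightarrow> real \<Rightarrow> real \<Rightarrow> 'm vfield" where
  "q_field M a as ah \<alpha>1 \<alpha>2 \<alpha>3 \<alpha>4 =
     (\<lambda>_. \<alpha>1) \<cdot> phi M (phi M as) - (\<lambda>_. \<alpha>2) \<cdot> phi M (phi M a)
     - (\<lambda>_. \<alpha>3) \<cdot> phi M ah + (\<lambda>_. \<alpha>4) \<cdot> ah"

definition family_torsion ::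
    "nat \<Rightarrow> ('m, 'e) acb_structure \<Rightarrow> 'm vfield \<Rightarrow> 'm vfield \<Rightarrow> 'm vfield \<Rightarrow>
     real \<Rightarrow> real \<Rightarrow> real \<Rightarrow> real \<Rightarrow>
     'm vfield \<Rightarrow> 'm vfield \<Rightarrow> 'm vfield \<Rightarrow> 'm \<Rightarrow> real" where
  "family_torsion n M a as ah \<alpha>1 \<alpha>2 \<alpha>3 \<alpha>4 x y z =
     lower M (pi3 M + pi5 M) x y z (q_field M a as ah \<alpha>1 \<alpha>2 \<alpha>3 \<alpha>4)
     + (\<lambda>_. 1 / (2 * real n)) * lower M (pi2 M + pi4 M) x y z as
     + (\<lambda>_. 1 / (2 * real n)) * lower M (pi5 M) x y z a
     - lower M (pi5 M) x y z ah"

definition canonical_torsion ::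
    "nat \<Rightarrow> ('m, 'e) acb_structure \<Rightarrow> 'm vfield \<Rightarrow> 'm vfield \<Rightarrow> 'm vfield \<Rightarrow>
     'm vfield \<Rightarrow> 'm vfield \<Rightarrow> 'm vfield \<Rightarrow> 'm \<Rightarrow> real" where
  "canonical_torsion n M a as ah x y z =
     (\<lambda>_. 1 / (4 * real n)) * lower M (pi1 M + pi2 M + pi4 M) x y z as
     + (\<lambda>_. 1 / (2 * real n)) * lower M (pi5 M) x y z a
     - lower M (pi5 M) x y z ah"

text \<open>Linear independence over the real numbers of the four vector fields that \<open>q\<close> combines: \<open>q\<close>
  determines its coefficients.\<close>

definition independent_parameters ::
    "('m, 'e) acb_structure \<Rightarrow> 'm vfield \<Rightarrow> 'm vfield \<Rightarrow> 'm vfield \<Rightarrow> bool" where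
  "independent_parameters M a as ah \<longleftrightarrow>
     (\<forall>c1 c2 c3 c4. (\<lambda>_. c1) \<cdot> phi M (phi M as) + (\<lambda>_. c2) \<cdot> phi M (phi M a)
        + (\<lambda>_. c3) \<cdot> phi M ah + (\<lambda>_. c4) \<cdot> ah = 0 \<longrightarrow> c1 = 0 \<and> c2 = 0 \<and> c3 = 0 \<and> c4 = 0)"

end

theory Submission
  imports Defs
begin

text \<open>
  The condition that singles out the \<open>\<phi>\<close>-canonical connection is linear in the torsion; let \<open>C(T)\<close> be its
  left-hand side. The torsion of a member of the family is \<open>T\<^sub>0 + P\<close>, where \<open>T\<^sub>0\<close> is the member with
  \<open>\<alpha>\<^sub>1 = \<alpha>\<^sub>3 = \<alpha>\<^sub>4 = 0\<close> and \<open>\<alpha>\<^sub>2 = 1 / (4 n)\<close>, and \<open>P = (\<pi>\<^sub>3 + \<pi>\<^sub>5)(\<cdot>, \<cdot>, \<cdot>, r)\<close> with a vector field \<open>r\<close> that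
  depends linearly on the deviations of the parameters from these values. Everything follows from three
  computations. The tensor \<open>T\<^sub>0\<close> is the torsion \<open>T\<^sup>0\<close> of the statement
  (\<open>family_torsion_eq_canonical_torsion\<close>). It satisfies \<open>C(T\<^sub>0) = 0\<close>
  (\<open>canonical_defect_canonical_torsion\<close>). Finally \<open>C(P)(x, y, z) = - 2 P(y, z, x)\<close>
  (\<open>canonical_defect_pi35\<close>). So the connection is \<open>\<phi>\<close>-canonical iff \<open>P = 0\<close>, that is, iff its torsion is
  \<open>T\<^sub>0\<close>.

  Beyond the algebra of \<open>\<phi>\<close>, \<open>\<xi>\<close>, \<open>\<eta>\<close> and \<open>g\<close>, these computations rest on two facts: \<open>\<eta>\<close> vanishes on the
  dual of \<open>\<omega>\<close>, and \<open>\<theta>\<^sup>* \<circ> \<phi> = - \<theta> \<circ> \<phi>\<^sup>2\<close>. The latter comes from the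
  behaviour of \<open>F\<close> when \<open>\<phi>\<close> is applied to its last two arguments (\<open>F_phi_phi\<close>, \<open>theta_star_phi\<close>).

  To recover the parameters themselves, \<open>P = 0\<close> has to imply \<open>r = 0\<close>. This is where \<open>n \<ge> 2\<close> enters: there
  must be a tangent vector in the common kernel of \<open>\<eta>\<close>, \<open>g(\<cdot>, r)\<close> and \<open>g(\<cdot>, \<phi> r)\<close> (\<open>pi35_eq_0_imp_eq_0\<close>).
  Linear independence of the four fields in \<open>q\<close> then gives the coefficients.

  Underneath lies one fact about manifolds: a one-form at a point depends only on the value of the
  vector field at that point (\<open>one_form_local\<close>), which makes the metric nondegenerate on vector fields
  and yields adapted bases. It is obtained from the existence of a frame of the same length at every
  point: fraction-free Gauss elimination turns a frame at \<open>p\<close> into vector fields \<open>E\<^sub>i\<close> and functions \<open>f\<^sub>i\<close>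
  with \<open>E\<^sub>i f\<^sub>j = v \<delta>\<^sub>i\<^sub>j\<close> and \<open>v(p) \<noteq> 0\<close>, and then \<open>v\<^sup>2 X = \<Sum>\<^sub>i v (X f\<^sub>i) E\<^sub>i\<close> holds globally for every vector
  field \<open>X\<close> (\<open>frame_elimination\<close>, \<open>local_expansion\<close>).
\<close>

section \<open>The algebra of smooth functions\<close>

text \<open>The derivative at a point of an open set sees only the values on that set, so the recursion
  defining \<open>C\<^sup>k\<close> can be entered with any function that agrees there. The product rule is used in this
  form below: it holds at the points of the set only.\<close>

lemma Ck_on_cong:
  assumes "open S" "\<And>x. x \<in> S \<Longrightarrow> f x = h x" "Ck_on k S f"
  shows "Ck_on k S h"
  using assms(2,3)
proof (induction k arbitrary: f h)
  case 0
  then show ?case by (metis Ck_on.simps(1) continuous_on_cong)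
next
  case (Suc k)
  have diff: "f differentiable at x" if "x \<in> S" for x
    using Suc.prems(2) that by simp
  have "h differentiable at x" if "x \<in> S" for x
    using diff[OF that] Suc.prems(1) assms(1) that
    by (metis differentiable_def has_derivative_transform_within_open)
  moreover have "frechet_derivative f (at x) = frechet_derivative h (at x)" if "x \<in> S" for x
    using frechet_derivative_transform_within_open[OF diff[OF that] assms(1) that Suc.prems(1)] .
  then have "Ck_on k S (\<lambda>x. frechet_derivative h (at x) v)" for v
    using Suc.IH[of "\<lambda>x. frechet_derivative f (at x) v" "\<lambda>x. frechet_derivative h (at x) v"]
      Suc.prems(2) by simp
  ultimately show ?case by simp
qed

lemma Ck_on_Suc_imp_Ck_on: "Ck_on (Suc k) S f \<Longrightarrow> Ck_on k S f"
proof (induction k arbitrary: f)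
  case 0
  then show ?case
    by (auto intro!: continuous_at_imp_continuous_on differentiable_imp_continuous_within)
next
  case (Suc k)
  then show ?case by (metis Ck_on.simps(2))
qed

lemma Ck_on_const: "Ck_on k S (\<lambda>_. c)"
  by (induction k arbitrary: c) auto

lemma Ck_on_add:
  assumes "open S" "Ck_on k S f" "Ck_on k S h"
  shows "Ck_on k S (\<lambda>x. f x + h x)"
  using assms(2,3)
proof (induction k arbitrary: f h)
  case 0
  then show ?case by (simp add: continuous_on_add)
next
  case (Suc k)
  have deriv: "((\<lambda>x. f x + h x) has_derivative
      (\<lambda>v. frechet_derivative f (at x) v + frechet_derivative h (at x) v)) (at x)" if "x \<in> S" for x
    using Suc.prems that by (auto intro!: has_derivative_add simp flip: frechet_derivative_works)
  have "Ck_on k S (\<lambda>x. frechet_derivative (\<lambda>x. f x + h x) (at x) v)" for v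
  proof (rule Ck_on_cong[OF assms(1)])
    show "Ck_on k S (\<lambda>x. frechet_derivative f (at x) v + frechet_derivative h (at x) v)"
      using Suc by simp
  qed (simp flip: frechet_derivative_at[OF deriv])
  then show ?case using deriv by (auto intro: differentiableI)
qed

lemma Ck_on_mult:
  fixes f h :: "'a::euclidean_space \<Rightarrow> real"
  assumes "open S" "Ck_on k S f" "Ck_on k S h"
  shows "Ck_on k S (\<lambda>x. f x * h x)"
  using assms(2,3)
proof (induction k arbitrary: f h)
  case 0
  then show ?case by (simp add: continuous_on_mult)
next
  case (Suc k)
  have deriv: "((\<lambda>x. f x * h x) has_derivative
      (\<lambda>v. f x * frechet_derivative h (at x) v + frechet_derivative f (at x) v * h x)) (at x)"
    if "x \<in> S" for x
    using Suc.prems that by (auto intro!: has_derivative_mult simp flip: frechet_derivative_works)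
  have "Ck_on k S (\<lambda>x. frechet_derivative (\<lambda>x. f x * h x) (at x) v)" for v
  proof (rule Ck_on_cong[OF assms(1)])
    show "Ck_on k S (\<lambda>x. f x * frechet_derivative h (at x) v + frechet_derivative f (at x) v * h x)"
      using Suc by (intro Ck_on_add assms(1) Suc.IH) (auto dest: Ck_on_Suc_imp_Ck_on simp del: Ck_on.simps(2), auto)
  qed (simp flip: frechet_derivative_at[OF deriv])
  then show ?case using deriv by (auto intro: differentiableI)
qed

lemma smooth_funs_const: "(\<lambda>_. c) \<in> smooth_funs A"
  by (auto simp: smooth_funs_def smooth_on_def comp_def Ck_on_const)

lemma smooth_funs_add:
  assumes "smooth_atlas A" "f \<in> smooth_funs A" "h \<in> smooth_funs A"
  shows "f + h \<in> smooth_funs A"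
  using assms unfolding smooth_funs_def smooth_on_def smooth_atlas_def comp_def plus_fun_def
  by (fastforce intro!: Ck_on_add)

lemma smooth_funs_mult:
  assumes "smooth_atlas A" "f \<in> smooth_funs A" "h \<in> smooth_funs A"
  shows "f * h \<in> smooth_funs A"
  using assms unfolding smooth_funs_def smooth_on_def smooth_atlas_def comp_def times_fun_def
  by (fastforce intro!: Ck_on_mult)

section \<open>The module of vector fields\<close>

lemma fmult_apply [simp]: "(f \<cdot> X) h p = f p * X h p"
  by (simp add: fmult_def)

lemma sum_fun_apply: "(\<Sum>i\<in>I. F i) x = (\<Sum>i\<in>I. F i x)"
  by (induction I rule: infinite_finite_induct) auto

lemma vfields_smooth: "X \<in> vfields A \<Longrightarrow> X f \<in> smooth_funs A"
  by (cases "f \<in> smooth_funs A")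
    (auto simp: vfields_def zero_fun_def smooth_funs_const)

lemma vfields_fmult:
  assumes "smooth_atlas A" "f \<in> smooth_funs A" "X \<in> vfields A"
  shows "f \<cdot> X \<in> vfields A"
  unfolding vfields_def mem_Collect_eq
proof (intro conjI ballI allI impI)
  fix h assume "h \<in> smooth_funs A" then show "(f \<cdot> X) h \<in> smooth_funs A"
    using assms by (simp add: fmult_def smooth_funs_mult vfields_smooth)
next
  fix h assume "h \<notin> smooth_funs A" then show "(f \<cdot> X) h = 0"
    using assms by (simp add: fmult_def vfields_def)
next
  fix h k c d assume "h \<in> smooth_funs A" "k \<in> smooth_funs A"
  then show "(f \<cdot> X) ((\<lambda>_. c) * h + (\<lambda>_. d) * k) = (\<lambda>_. c) * (f \<cdot> X) h + (\<lambda>_. d) * (f \<cdot> X) k"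
    using assms(3) by (simp add: vfields_def fun_eq_iff algebra_simps)
next
  fix h k assume "h \<in> smooth_funs A" "k \<in> smooth_funs A"
  then show "(f \<cdot> X) (h * k) = h * (f \<cdot> X) k + k * (f \<cdot> X) h"
    using assms(3) by (simp add: vfields_def fun_eq_iff algebra_simps)
qed

lemma vfields_add:
  assumes "smooth_atlas A" "X \<in> vfields A" "Y \<in> vfields A"
  shows "X + Y \<in> vfields A"
  unfolding vfields_def mem_Collect_eq
proof (intro conjI ballI allI impI)
  fix h assume "h \<in> smooth_funs A" then show "(X + Y) h \<in> smooth_funs A"
    using assms by (simp add: smooth_funs_add vfields_smooth)
next
  fix h assume "h \<notin> smooth_funs A" then show "(X + Y) h = 0"
    using assms by (simp add: vfields_def)
next
  fix h k c d assume "h \<in> smooth_funs A" "k \<in> smooth_funs A"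
  then show "(X + Y) ((\<lambda>_. c) * h + (\<lambda>_. d) * k) = (\<lambda>_. c) * (X + Y) h + (\<lambda>_. d) * (X + Y) k"
    using assms(2,3) by (simp add: vfields_def fun_eq_iff algebra_simps)
next
  fix h k assume "h \<in> smooth_funs A" "k \<in> smooth_funs A"
  then show "(X + Y) (h * k) = h * (X + Y) k + k * (X + Y) h"
    using assms(2,3) by (simp add: vfields_def fun_eq_iff algebra_simps)
qed

lemma uminus_vfield_eq: "- X = (\<lambda>_. - 1) \<cdot> (X :: 'm vfield)"
  by (auto simp: fun_eq_iff)

lemma diff_vfield_eq: "X - Y = X + (\<lambda>_. - 1) \<cdot> (Y :: 'm vfield)"
  by (auto simp: fun_eq_iff)

lemma vfields_zero: "0 \<in> vfields A"
  by (auto simp: vfields_def zero_fun_def fun_eq_iff smooth_funs_const)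

lemma vfields_uminus: "smooth_atlas A \<Longrightarrow> X \<in> vfields A \<Longrightarrow> - X \<in> vfields A"
  by (simp add: uminus_vfield_eq vfields_fmult smooth_funs_const)

lemma vfields_diff:
  "smooth_atlas A \<Longrightarrow> X \<in> vfields A \<Longrightarrow> Y \<in> vfields A \<Longrightarrow> X - Y \<in> vfields A"
  by (simp add: diff_vfield_eq vfields_add vfields_fmult smooth_funs_const)

lemma vfields_sum:
  "smooth_atlas A \<Longrightarrow> (\<And>i. i \<in> I \<Longrightarrow> X i \<in> vfields A) \<Longrightarrow> (\<Sum>i\<in>I. X i) \<in> vfields A"
  by (induction I rule: infinite_finite_induct) (auto simp: vfields_zero vfields_add)

lemma vfields_imp_tangent: "X \<in> vfields A \<Longrightarrow> (\<lambda>f. X f p) \<in> tangent_space A p"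
  by (auto simp: vfields_def tangent_space_def)

lemma vfields_const_fun:
  assumes "X \<in> vfields A" shows "X (\<lambda>_. c) = 0"
proof -
  have 1: "(1 :: 'a \<Rightarrow> real) \<in> smooth_funs A"
    by (simp add: smooth_funs_const one_fun_def)
  have "X (1 * 1) = 1 * X 1 + 1 * X 1"
    using assms 1 unfolding vfields_def by blast
  then have "X 1 = 0" by simp
  moreover have "X ((\<lambda>_. c) * 1 + (\<lambda>_. 0) * 1) = (\<lambda>_. c) * X 1 + (\<lambda>_. 0) * X 1"
    using assms 1 unfolding vfields_def by blast
  moreover have "(\<lambda>_. c) * 1 + (\<lambda>_. 0) * 1 = (\<lambda>_::'a. c)" by (simp add: fun_eq_iff)
  ultimately show ?thesis by simp
qed

section \<open>Pointwise frames\<close>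

text \<open>All dimension counts below are instances: the one for tangent spaces as well as the choice of a
  vector in the common kernel of three functionals. The proof eliminates one unknown per equation.\<close>

lemma underdetermined_system:
  fixes a :: "nat \<Rightarrow> nat \<Rightarrow> real"
  assumes "k < m"
  shows "\<exists>c. (\<exists>i<m. c i \<noteq> 0) \<and> (\<forall>j<k. (\<Sum>i<m. c i * a i j) = 0)"
  using assms
proof (induction k arbitrary: m a)
  case 0
  then show ?case by (intro exI[of _ "\<lambda>_. 1"]) auto
next
  case (Suc k)
  obtain m' where m': "m = Suc m'" "k < m'" using Suc.prems by (cases m) auto
  show ?case
  proof (cases "\<forall>i<m. a i k = 0")
    case True
    obtain c where "\<exists>i<m. c i \<noteq> 0" "\<forall>j<k. (\<Sum>i<m. c i * a i j) = 0"
      using Suc.IH[of m a] Suc.prems by auto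
    with True show ?thesis by (auto simp: less_Suc_eq)
  next
    case False
    then obtain r where r: "r < m" "a r k \<noteq> 0" by auto
    \<comment> \<open>The unknown \<open>r\<close> is eliminated through equation \<open>k\<close>; \<open>s\<close> enumerates the other unknowns.\<close>
    define s where "s i = (if i < r then i else Suc i)" for i
    have bij: "bij_betw s {..<m'} ({..<m} - {r})"
      unfolding bij_betw_def
    proof
      show "inj_on s {..<m'}" by (auto simp: inj_on_def s_def split: if_splits)
      show "s ` {..<m'} = {..<m} - {r}"
      proof
        show "s ` {..<m'} \<subseteq> {..<m} - {r}" by (auto simp: s_def m')
        show "{..<m} - {r} \<subseteq> s ` {..<m'}"
        proof
          fix i assume i: "i \<in> {..<m} - {r}"
          show "i \<in> s ` {..<m'}"
          proof (cases "i < r")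
            case True then show ?thesis using i r m' by (intro image_eqI[of _ _ i]) (auto simp: s_def)
          next
            case False then show ?thesis using i r m' by (intro image_eqI[of _ _ "i - 1"]) (auto simp: s_def)
          qed
        qed
      qed
    qed
    define b where "b i j = a (s i) j - a (s i) k / a r k * a r j" for i j
    obtain d where d: "\<exists>i<m'. d i \<noteq> 0" "\<forall>j<k. (\<Sum>i<m'. d i * b i j) = 0"
      using Suc.IH[of m' b] m' by auto
    define t where "t = the_inv_into {..<m'} s"
    have ts: "t (s i) = i" if "i < m'" for i
      using bij that unfolding t_def bij_betw_def by (auto intro: the_inv_into_f_f)
    define c where "c i = (if i = r then - (\<Sum>i<m'. d i * a (s i) k) / a r k else d (t i))" for i
    have sr: "s i \<noteq> r" for i by (auto simp: s_def)
    have sum: "(\<Sum>i<m. c i * a i j) = (\<Sum>i<m'. d i * b i j)" for j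
    proof -
      have "(\<Sum>i<m. c i * a i j) = c r * a r j + (\<Sum>i\<in>{..<m} - {r}. c i * a i j)"
        using r by (simp add: sum.remove)
      also have "(\<Sum>i\<in>{..<m} - {r}. c i * a i j) = (\<Sum>i<m'. c (s i) * a (s i) j)"
        using sum.reindex_bij_betw[OF bij, of "\<lambda>i. c i * a i j"] by simp
      also have "\<dots> = (\<Sum>i<m'. d i * a (s i) j)"
        by (intro sum.cong) (auto simp: c_def ts sr)
      also have "c r * a r j = - (\<Sum>i<m'. d i * (a (s i) k / a r k * a r j))"
        by (simp add: c_def sum_distrib_right sum_distrib_left sum_divide_distrib mult_ac)
      finally show ?thesis by (simp add: b_def right_diff_distrib sum_subtractf)
    qed
    have "b i k = 0" for i using r by (simp add: b_def)
    then have "(\<Sum>i<m. c i * a i j) = 0" if "j < Suc k" for j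
      using that d(2) by (auto simp: sum less_Suc_eq)
    moreover have "\<exists>i<m. c i \<noteq> 0"
    proof -
      obtain i where i: "i < m'" "d i \<noteq> 0" using d by auto
      then have "s i < m" by (auto simp: s_def m')
      moreover have "c (s i) \<noteq> 0" using i by (simp add: c_def sr ts)
      ultimately show ?thesis by auto
    qed
    ultimately show ?thesis by blast
  qed
qed

text \<open>Every tangent space that has some frame of \<open>N\<close> vectors is \<open>N\<close>-dimensional, so independence is
  enough: a tangent vector and the \<open>e i\<close> are \<open>N + 1\<close> combinations of the \<open>N\<close> vectors \<open>b j\<close>, hence
  dependent, and the tangent vector occurs in the relation.\<close>

lemma frame_atI_independent:
  assumes "frame_at A p N b"
    and vf: "\<And>i. i < N \<Longrightarrow> e i \<in> vfields A"
    and indep: "\<And>c. (\<And>f. (\<Sum>i<N. c i * e i f p) = 0) \<Longrightarrow> \<forall>i<N. c i = 0"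
  shows "frame_at A p N e"
proof -
  have "\<exists>c. \<forall>f. v f = (\<Sum>i<N. c i * e i f p)" if v: "v \<in> tangent_space A p" for v
  proof -
    have span: "\<exists>c. \<forall>f. w f = (\<Sum>j<N. c j * b j f p)" if "w \<in> tangent_space A p" for w
      using assms(1) that unfolding frame_at_def by blast
    have "\<forall>i. \<exists>c. i < N \<longrightarrow> (\<forall>f. e i f p = (\<Sum>j<N. c j * b j f p))"
      using span[OF vfields_imp_tangent[OF vf]] by blast
    then obtain C where C: "\<And>i f. i < N \<Longrightarrow> e i f p = (\<Sum>j<N. C i j * b j f p)" by metis
    obtain B where B: "\<And>f. v f = (\<Sum>j<N. B j * b j f p)" using span[OF v] by blast
    define a where "a i j = (if i < N then C i j else B j)" for i j
    obtain c where c: "\<exists>i<Suc N. c i \<noteq> 0" "\<forall>j<N. (\<Sum>i<Suc N. c i * a i j) = 0"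
      using underdetermined_system[of N "Suc N" a] by blast
    have rel: "(\<Sum>i<N. c i * e i f p) + c N * v f = 0" for f
    proof -
      have "(\<Sum>i<N. c i * e i f p) + c N * v f = (\<Sum>i<Suc N. \<Sum>j<N. c i * a i j * b j f p)"
        by (simp add: C B a_def sum_distrib_left mult.assoc)
      also have "\<dots> = (\<Sum>j<N. (\<Sum>i<Suc N. c i * a i j) * b j f p)"
        by (subst sum.swap) (simp only: sum_distrib_right)
      finally show ?thesis using c(2) by simp
    qed
    have "c N \<noteq> 0"
    proof
      assume "c N = 0"
      with rel indep[of c] c(1) show False by (auto simp: less_Suc_eq)
    qed
    then have "v f = (\<Sum>i<N. - (c i / c N) * e i f p)" for f
      using rel[of f] by (simp add: sum_negf field_simps flip: sum_divide_distrib)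
    then show ?thesis by (intro exI[of _ "\<lambda>i. - (c i / c N)"]) auto
  qed
  then show ?thesis
    using vf indep unfolding frame_at_def by blast
qed

text \<open>Gauss elimination over the ring of smooth functions. Its pivots are smooth functions that
  do not vanish at \<open>p\<close>; instead of dividing by them, they are collected in the factor \<open>v\<close>.\<close>

lemma frame_elimination:
  assumes at: "smooth_atlas A" and fr: "frame_at A p N e" and "k \<le> N"
  shows "\<exists>E f v. v \<in> smooth_funs A \<and> v p \<noteq> 0 \<and>
     (\<forall>i<k. E i \<in> vfields A \<and> f i \<in> smooth_funs A \<and>
        (\<exists>c. (\<forall>j\<ge>k. c j = 0) \<and> (\<forall>h. E i h p = (\<Sum>j<N. c j * e j h p)))) \<and>
     (\<forall>i<k. \<forall>j<k. E i (f j) = (if i = j then v else 0))"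
  using assms(3)
proof (induction k)
  case 0
  show ?case by (intro exI[of _ "\<lambda>_. 0"] exI[of _ "\<lambda>_. 1"]) (simp add: smooth_funs_const)
next
  case (Suc k)
  then have "k \<le> N" by simp
  from Suc.IH[OF this] obtain E f v where v: "v \<in> smooth_funs A" "v p \<noteq> 0"
    and IH: "\<forall>i<k. E i \<in> vfields A \<and> f i \<in> smooth_funs A \<and>
        (\<exists>c. (\<forall>j\<ge>k. c j = 0) \<and> (\<forall>h. E i h p = (\<Sum>j<N. c j * e j h p)))"
      "\<forall>i<k. \<forall>j<k. E i (f j) = (if i = j then v else 0)"
    by (elim exE conjE)
  have E: "E i \<in> vfields A" and f: "f i \<in> smooth_funs A" if "i < k" for i
    using IH(1) that by blast+
  have ex: "\<forall>i<k. \<exists>c. (\<forall>j\<ge>k. c j = 0) \<and> (\<forall>h. E i h p = (\<Sum>j<N. c j * e j h p))"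
    using IH(1) by blast
  have dual: "E i (f j) = (if i = j then v else 0)" if "i < k" "j < k" for i j
    using IH(2) that by blast
  have e: "e i \<in> vfields A" if "i < N" for i using fr that by (simp add: frame_at_def)
  have k: "k < N" using Suc.prems by simp
  obtain C where C0: "\<And>i j. i < k \<Longrightarrow> j \<ge> k \<Longrightarrow> C i j = 0"
    and C: "\<And>i h. i < k \<Longrightarrow> E i h p = (\<Sum>j<N. C i j * e j h p)"
    using ex by metis
  \<comment> \<open>\<open>G\<close> is \<open>e k\<close> after clearing its derivatives along \<open>f 0, \<dots>, f (k - 1)\<close>, scaled by \<open>v\<close>.\<close>
  define G where "G = v \<cdot> e k - (\<Sum>i<k. e k (f i) \<cdot> E i)"
  have G: "G \<in> vfields A"
    unfolding G_def by (intro vfields_diff vfields_sum vfields_fmult at v E e k vfields_smooth) auto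
  have Gf: "G (f j) = 0" if "j < k" for j
  proof -
    have "(\<Sum>i<k. (e k (f i) \<cdot> E i) (f j)) = (\<Sum>i<k. if i = j then e k (f j) * v else 0)"
      using that by (intro sum.cong) (auto simp: dual fmult_def)
    then show ?thesis
      using that by (simp add: G_def sum_fun_apply) (simp add: fmult_def mult.commute)
  qed
  define c' where "c' j = (if j = k then v p else 0) - (\<Sum>i<k. e k (f i) p * C i j)" for j
  have c'0: "c' j = 0" if "j \<ge> Suc k" for j using that C0 by (simp add: c'_def)
  have c'k: "c' k = v p" using C0 by (simp add: c'_def)
  have Gp: "G h p = (\<Sum>j<N. c' j * e j h p)" for h
  proof -
    have "(\<Sum>j<N. c' j * e j h p) =
        (\<Sum>j<N. (if j = k then v p else 0) * e j h p) - (\<Sum>j<N. \<Sum>i<k. e k (f i) p * C i j * e j h p)"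
      by (simp add: c'_def left_diff_distrib sum_subtractf sum_distrib_right)
    also have "(\<Sum>j<N. (if j = k then v p else 0) * e j h p) = v p * e k h p"
      using k by (simp add: if_distrib[of "\<lambda>x. x * _"] cong: if_cong)
    also have "(\<Sum>j<N. \<Sum>i<k. e k (f i) p * C i j * e j h p) = (\<Sum>i<k. e k (f i) p * E i h p)"
      by (subst sum.swap) (simp add: C sum_distrib_left mult.assoc)
    finally show ?thesis by (simp add: G_def sum_fun_apply)
  qed
  \<comment> \<open>The next test function is one that the reduced field does not annihilate at \<open>p\<close>.\<close>
  have "\<exists>h. G h p \<noteq> 0"
  proof (rule ccontr)
    assume "\<nexists>h. G h p \<noteq> 0"
    then have "\<forall>h. (\<Sum>j<N. c' j * e j h p) = 0" by (simp add: Gp)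
    then have "c' k = 0" using fr k unfolding frame_at_def by blast
    then show False using c'k v by simp
  qed
  then obtain h where h: "G h p \<noteq> 0" by blast
  have hS: "h \<in> smooth_funs A"
  proof (rule ccontr)
    assume "h \<notin> smooth_funs A"
    then have "G h = 0" using G by (simp add: vfields_def)
    then show False using h by simp
  qed
  define w where "w = G h"
  have w: "w \<in> smooth_funs A" "w p \<noteq> 0" using G h by (auto simp: w_def vfields_smooth)
  define E' where "E' i = (if i < k then w \<cdot> E i - E i h \<cdot> G else v \<cdot> G)" for i
  define f' where "f' i = (if i < k then f i else h)" for i
  show ?case
  proof (intro exI[of _ E'] exI[of _ f'] exI[of _ "v * w"] conjI allI impI)
    show "v * w \<in> smooth_funs A" by (intro smooth_funs_mult at v w)
    show "(v * w) p \<noteq> 0" using v w by simp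
  next
    fix i assume "i < Suc k"
    then show "E' i \<in> vfields A" "f' i \<in> smooth_funs A"
      unfolding E'_def f'_def
      by (auto intro!: vfields_diff vfields_fmult at v w E G f hS E[THEN vfields_smooth])
  next
    fix i assume i: "i < Suc k"
    show "\<exists>c. (\<forall>j\<ge>Suc k. c j = 0) \<and> (\<forall>h. E' i h p = (\<Sum>j<N. c j * e j h p))"
    proof (cases "i < k")
      case True
      then show ?thesis
        by (intro exI[of _ "\<lambda>j. w p * C i j - E i h p * c' j"])
          (auto simp: E'_def C0 c'0 Gp C[OF True] left_diff_distrib sum_subtractf sum_distrib_left mult.assoc)
    next
      case False
      then show ?thesis
        by (intro exI[of _ "\<lambda>j. v p * c' j"])
          (auto simp: E'_def c'0 Gp sum_distrib_left mult.assoc)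
    qed
  next
    fix i j assume "i < Suc k" "j < Suc k"
    then show "E' i (f' j) = (if i = j then v * w else 0)"
      by (auto simp: E'_def f'_def fmult_def dual Gf less_Suc_eq mult.commute simp flip: w_def)
  qed
qed

text \<open>Where \<open>v\<close> does not vanish, the fields produced by elimination are again a frame and \<open>f\<close> reads off
  the coefficients of \<open>X\<close>; where \<open>v\<close> vanishes, both sides are \<open>0\<close>. The second factor \<open>v\<close> is there for
  this reason: it makes a local expansion an identity of global vector fields, without bump functions
  and without charts.\<close>

lemma local_expansion:
  assumes at: "smooth_atlas A" and frames: "\<And>q. \<exists>b. frame_at A q N b"
  shows "\<exists>E f v. v \<in> smooth_funs A \<and> v p \<noteq> 0 \<and> (\<forall>i<N. E i \<in> vfields A) \<and>
     (\<forall>X\<in>vfields A. (v * v) \<cdot> X = (\<Sum>i<N. (v * X (f i)) \<cdot> E i))"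
proof -
  obtain e where "frame_at A p N e" using frames by blast
  from frame_elimination[OF at this le_refl]
  obtain E f v where v: "v \<in> smooth_funs A" "v p \<noteq> 0"
    and E: "\<And>i. i < N \<Longrightarrow> E i \<in> vfields A" and f: "\<And>i. i < N \<Longrightarrow> f i \<in> smooth_funs A"
    and dual: "\<And>i j. i < N \<Longrightarrow> j < N \<Longrightarrow> E i (f j) = (if i = j then v else 0)"
    by blast
  have "((v * v) \<cdot> X) h q = (\<Sum>i<N. (v * X (f i)) \<cdot> E i) h q" if X: "X \<in> vfields A" for X h q
  proof (cases "v q = 0")
    case True
    then show ?thesis by (simp add: sum_fun_apply)
  next
    case False
    have pick: "(\<Sum>i<N. c i * E i (f j) q) = c j * v q" if "j < N" for c j
    proof -
      have "(\<Sum>i<N. c i * E i (f j) q) = (\<Sum>i<N. if i = j then c i * v q else 0)"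
        using that by (intro sum.cong) (auto simp: dual)
      then show ?thesis using that by simp
    qed
    obtain b where b: "frame_at A q N b" using frames by blast
    have fr: "frame_at A q N E"
    proof (rule frame_atI_independent[OF b E])
      fix c assume "\<And>h. (\<Sum>i<N. c i * E i h q) = 0"
      then show "\<forall>i<N. c i = 0" using pick False by (metis mult_eq_0_iff)
    qed
    \<comment> \<open>\<open>Y\<close> is the difference of both sides before the second factor \<open>v\<close> is multiplied in.\<close>
    define Y where "Y = v \<cdot> X - (\<Sum>i<N. X (f i) \<cdot> E i)"
    have "Y \<in> vfields A"
      unfolding Y_def using X by (intro vfields_diff vfields_sum vfields_fmult at v E vfields_smooth) auto
    then have Yq: "(\<lambda>h. Y h q) \<in> tangent_space A q" by (rule vfields_imp_tangent)
    have "\<forall>v\<in>tangent_space A q. \<exists>c. \<forall>h. v h = (\<Sum>i<N. c i * E i h q)"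
      using fr by (simp add: frame_at_def)
    from bspec[OF this Yq] obtain c where c: "\<And>h. Y h q = (\<Sum>i<N. c i * E i h q)" by blast
    have "c j = 0" if "j < N" for j
    proof -
      have "Y (f j) q = 0"
        using pick[OF that, of "\<lambda>i. X (f i) q"] by (simp add: Y_def sum_fun_apply)
      then show ?thesis using c[of "f j"] pick[OF that, of c] False by simp
    qed
    then have "Y h q = 0" using c by simp
    then show ?thesis by (simp add: Y_def sum_fun_apply mult.assoc flip: sum_distrib_left)
  qed
  then have "(v * v) \<cdot> X = (\<Sum>i<N. (v * X (f i)) \<cdot> E i)" if "X \<in> vfields A" for X
    using that by (intro ext)
  then show ?thesis using v E by blast
qed

section \<open>Pointwise values of one-forms\<close>

lemma one_form_fmult:
  assumes "one_form A \<omega>" "f \<in> smooth_funs A" "X \<in> vfields A"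
  shows "\<omega> (f \<cdot> X) = f * \<omega> X"
proof -
  have "\<omega> (f \<cdot> X + (\<lambda>_. 0) \<cdot> X) = f * \<omega> X + (\<lambda>_. 0) * \<omega> X"
    using assms smooth_funs_const unfolding one_form_def by blast
  moreover have "f \<cdot> X + (\<lambda>_. 0) \<cdot> X = f \<cdot> X" "f * \<omega> X + (\<lambda>_. 0) * \<omega> X = f * \<omega> X"
    by (simp_all add: fun_eq_iff)
  ultimately show ?thesis by simp
qed

lemma one_form_add:
  assumes "one_form A \<omega>" "X \<in> vfields A" "Y \<in> vfields A"
  shows "\<omega> (X + Y) = \<omega> X + \<omega> Y"
proof -
  have "\<omega> ((\<lambda>_. 1) \<cdot> X + (\<lambda>_. 1) \<cdot> Y) = (\<lambda>_. 1) * \<omega> X + (\<lambda>_. 1) * \<omega> Y"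
    using assms smooth_funs_const unfolding one_form_def by blast
  moreover have "(\<lambda>_. 1) \<cdot> X + (\<lambda>_. 1) \<cdot> Y = X + Y" "(\<lambda>_. 1) * \<omega> X + (\<lambda>_. 1) * \<omega> Y = \<omega> X + \<omega> Y"
    by (simp_all add: fun_eq_iff)
  ultimately show ?thesis by simp
qed

lemma one_form_zero: "one_form A \<omega> \<Longrightarrow> \<omega> 0 = 0"
  using one_form_add[where X = 0 and Y = 0] by (simp add: vfields_zero)

lemma one_form_uminus: "one_form A \<omega> \<Longrightarrow> X \<in> vfields A \<Longrightarrow> \<omega> (- X) = - \<omega> X"
  by (simp add: uminus_vfield_eq one_form_fmult smooth_funs_const) (simp add: fun_eq_iff)

lemma one_form_diff:
  assumes "smooth_atlas A" "one_form A \<omega>" "X \<in> vfields A" "Y \<in> vfields A"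
  shows "\<omega> (X - Y) = \<omega> X - \<omega> Y"
  using one_form_add[OF assms(2,3) vfields_uminus[OF assms(1,4)]] one_form_uminus[OF assms(2,4)]
  by simp

lemma one_form_sum:
  assumes "smooth_atlas A" "one_form A \<omega>" "\<And>i. i \<in> I \<Longrightarrow> X i \<in> vfields A"
  shows "\<omega> (\<Sum>i\<in>I. X i) = (\<Sum>i\<in>I. \<omega> (X i))"
  using assms(3)
  by (induction I rule: infinite_finite_induct)
    (auto simp: one_form_zero[OF assms(2)] one_form_add[OF assms(2)] vfields_sum[OF assms(1)])

text \<open>Apply \<open>\<omega>\<close> to the expansion of \<open>(v * v) \<cdot> X\<close>: its coefficients \<open>v * X (f i)\<close> vanish at \<open>p\<close>. Thus the
  value of a one-form at a point depends on the value of the vector field there only.\<close>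

lemma one_form_local:
  assumes at: "smooth_atlas A" and frames: "\<And>q. \<exists>b. frame_at A q N b"
    and \<omega>: "one_form A \<omega>" and X: "X \<in> vfields A" and zero: "\<And>h. X h p = 0"
  shows "\<omega> X p = 0"
proof -
  obtain E f v where v: "v \<in> smooth_funs A" "v p \<noteq> 0" and E: "\<And>i. i < N \<Longrightarrow> E i \<in> vfields A"
    and ex: "(v * v) \<cdot> X = (\<Sum>i<N. (v * X (f i)) \<cdot> E i)"
    using local_expansion[OF at frames, of p] X by blast
  have S: "v * v \<in> smooth_funs A" "\<And>i. v * X (f i) \<in> smooth_funs A"
    using v by (simp_all add: smooth_funs_mult[OF at] vfields_smooth[OF X])
  have "(v * v) * \<omega> X = \<omega> (\<Sum>i<N. (v * X (f i)) \<cdot> E i)"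
    using one_form_fmult[OF \<omega> S(1) X] ex by simp
  also have "\<dots> = (\<Sum>i<N. (v * X (f i)) * \<omega> (E i))"
  proof (subst one_form_sum[OF at \<omega>])
    fix i assume "i \<in> {..<N}"
    then show "(v * X (f i)) \<cdot> E i \<in> vfields A" by (intro vfields_fmult at S E) auto
  next
    show "(\<Sum>i<N. \<omega> ((v * X (f i)) \<cdot> E i)) = (\<Sum>i<N. (v * X (f i)) * \<omega> (E i))"
      by (intro sum.cong refl one_form_fmult[OF \<omega>] S E) auto
  qed
  finally have "((v * v) * \<omega> X) p = (\<Sum>i<N. ((v * X (f i)) * \<omega> (E i)) p)"
    by (simp only: sum_fun_apply)
  then show ?thesis using v zero by simp
qed

section \<open>Almost contact B-metric manifolds\<close>

text \<open>The left-hand side of the condition that characterises \<open>\<phi>\<close>-canonical connections, as an operator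
  that is linear in the tensor \<open>T\<close>.\<close>

definition canonical_defect ::
    "('m, 'e::euclidean_space) acb_structure \<Rightarrow> ('m vfield \<Rightarrow> 'm vfield \<Rightarrow> 'm vfield \<Rightarrow> 'm \<Rightarrow> real) \<Rightarrow>
     'm vfield \<Rightarrow> 'm vfield \<Rightarrow> 'm vfield \<Rightarrow> 'm \<Rightarrow> real" where
  "canonical_defect M T x y z = swap_diff (\<lambda>y z.
      T x y z - T x (phi M y) (phi M z)
      - eta M x * (T (xi M) y z - T (xi M) (phi M y) (phi M z))
      - eta M y * (T x (xi M) z - T x z (xi M) - eta M x * T z (xi M) (xi M))) y z"

lemma phi_canonical_iff:
  "phi_canonical M D \<longleftrightarrow> natural_connection M D \<and>
     (\<forall>x\<in>VF M. \<forall>y\<in>VF M. \<forall>z\<in>VF M. canonical_defect M (torsion3 M D) x y z = 0)"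
  by (simp add: phi_canonical_def canonical_defect_def Let_def)

locale almost_contact_B_manifold =
  fixes n :: nat and M :: "('m::{t2_space,second_countable_topology}, 'e::euclidean_space) acb_structure"
  assumes acB: "almost_contact_B_metric n M"
begin

abbreviation g where "g \<equiv> bmetric M"
abbreviation \<phi> where "\<phi> \<equiv> phi M"
abbreviation \<xi> where "\<xi> \<equiv> xi M"
abbreviation \<eta> where "\<eta> \<equiv> eta M"
abbreviation S where "S \<equiv> smooth_funs (charts M)"

lemma atlas: "smooth_atlas (charts M)"
  using acB unfolding almost_contact_B_metric_def by blast

lemma one_form_g: "x \<in> VF M \<Longrightarrow> one_form (charts M) (g x)"
  using acB unfolding almost_contact_B_metric_def pseudo_metric_def by blast

lemma one_form_eta: "one_form (charts M) \<eta>"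
  using acB unfolding almost_contact_B_metric_def by blast

lemma VF_closed [simp]:
  "\<xi> \<in> VF M"
  "x \<in> VF M \<Longrightarrow> \<phi> x \<in> VF M"
  "x \<in> VF M \<Longrightarrow> y \<in> VF M \<Longrightarrow> x + y \<in> VF M"
  "x \<in> VF M \<Longrightarrow> y \<in> VF M \<Longrightarrow> x - y \<in> VF M"
  "x \<in> VF M \<Longrightarrow> - x \<in> VF M"
  "0 \<in> VF M"
  "f \<in> S \<Longrightarrow> x \<in> VF M \<Longrightarrow> f \<cdot> x \<in> VF M"
proof -
  show "\<xi> \<in> VF M" "x \<in> VF M \<Longrightarrow> \<phi> x \<in> VF M"
    using acB unfolding almost_contact_B_metric_def endomorphism_field_def by blast+
qed (simp_all add: atlas vfields_add vfields_diff vfields_uminus vfields_zero vfields_fmult)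

lemma smooth_closed [simp]:
  "(\<lambda>_. c) \<in> S"
  "f \<in> S \<Longrightarrow> h \<in> S \<Longrightarrow> f * h \<in> S"
  "x \<in> VF M \<Longrightarrow> \<eta> x \<in> S"
  "x \<in> VF M \<Longrightarrow> y \<in> VF M \<Longrightarrow> g x y \<in> S"
  using one_form_eta one_form_g[of x] atlas
  by (simp_all add: one_form_def smooth_funs_const smooth_funs_mult)

lemma g_sym: "x \<in> VF M \<Longrightarrow> y \<in> VF M \<Longrightarrow> g x y = g y x"
  using acB unfolding almost_contact_B_metric_def pseudo_metric_def by blast

lemma g_right [simp]:
  assumes "x \<in> VF M" "y \<in> VF M"
  shows "z \<in> VF M \<Longrightarrow> g x (y + z) = g x y + g x z"
    "z \<in> VF M \<Longrightarrow> g x (y - z) = g x y - g x z"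
    "g x (- y) = - g x y"
    "g x 0 = 0"
    "f \<in> S \<Longrightarrow> g x (f \<cdot> y) = f * g x y"
proof -
  note \<omega> = one_form_g[OF assms(1)]
  show "z \<in> VF M \<Longrightarrow> g x (y + z) = g x y + g x z" by (rule one_form_add[OF \<omega> assms(2)])
  show "z \<in> VF M \<Longrightarrow> g x (y - z) = g x y - g x z" by (rule one_form_diff[OF atlas \<omega> assms(2)])
  show "g x (- y) = - g x y" by (rule one_form_uminus[OF \<omega> assms(2)])
  show "g x 0 = 0" by (rule one_form_zero[OF \<omega>])
  show "f \<in> S \<Longrightarrow> g x (f \<cdot> y) = f * g x y" by (rule one_form_fmult[OF \<omega> _ assms(2)])
qed

lemma g_left [simp]:
  assumes "x \<in> VF M" "y \<in> VF M"
  shows "z \<in> VF M \<Longrightarrow> g (y + z) x = g y x + g z x"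
    "z \<in> VF M \<Longrightarrow> g (y - z) x = g y x - g z x"
    "g (- y) x = - g y x"
    "g 0 x = 0"
    "f \<in> S \<Longrightarrow> g (f \<cdot> y) x = f * g y x"
  using assms g_sym[of "y + z" x] g_sym[of "y - z" x] g_sym[of "- y" x] g_sym[of 0 x]
    g_sym[of "f \<cdot> y" x] g_sym[of y x] g_sym[of z x]
  by simp_all

lemma eta_linear [simp]:
  assumes "y \<in> VF M"
  shows "z \<in> VF M \<Longrightarrow> \<eta> (y + z) = \<eta> y + \<eta> z"
    "z \<in> VF M \<Longrightarrow> \<eta> (y - z) = \<eta> y - \<eta> z"
    "\<eta> (- y) = - \<eta> y"
    "\<eta> 0 = 0"
    "f \<in> S \<Longrightarrow> \<eta> (f \<cdot> y) = f * \<eta> y"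
proof -
  note \<omega> = one_form_eta
  show "z \<in> VF M \<Longrightarrow> \<eta> (y + z) = \<eta> y + \<eta> z" by (rule one_form_add[OF \<omega> assms])
  show "z \<in> VF M \<Longrightarrow> \<eta> (y - z) = \<eta> y - \<eta> z" by (rule one_form_diff[OF atlas \<omega> assms])
  show "\<eta> (- y) = - \<eta> y" by (rule one_form_uminus[OF \<omega> assms])
  show "\<eta> 0 = 0" by (rule one_form_zero[OF \<omega>])
  show "f \<in> S \<Longrightarrow> \<eta> (f \<cdot> y) = f * \<eta> y" by (rule one_form_fmult[OF \<omega> _ assms])
qed

lemma phi_xi [simp]: "\<phi> \<xi> = 0"
  and phi_phi: "x \<in> VF M \<Longrightarrow> \<phi> (\<phi> x) = - x + \<eta> x \<cdot> \<xi>"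
  and eta_phi [simp]: "x \<in> VF M \<Longrightarrow> \<eta> (\<phi> x) = 0"
  and eta_xi [simp]: "\<eta> \<xi> = 1"
  and g_phi_phi: "x \<in> VF M \<Longrightarrow> y \<in> VF M \<Longrightarrow> g (\<phi> x) (\<phi> y) = \<eta> x * \<eta> y - g x y"
proof -
  show "\<phi> \<xi> = 0" "x \<in> VF M \<Longrightarrow> \<phi> (\<phi> x) = - x + \<eta> x \<cdot> \<xi>" "x \<in> VF M \<Longrightarrow> \<eta> (\<phi> x) = 0" "\<eta> \<xi> = 1"
    using acB unfolding almost_contact_B_metric_def by blast+
  assume "x \<in> VF M" "y \<in> VF M"
  then have "g x y = - g (\<phi> x) (\<phi> y) + \<eta> x * \<eta> y"
    using acB unfolding almost_contact_B_metric_def by blast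
  then show "g (\<phi> x) (\<phi> y) = \<eta> x * \<eta> y - g x y" by simp
qed

lemma g_xi [simp]:
  assumes "x \<in> VF M"
  shows "g x \<xi> = \<eta> x" "g \<xi> x = \<eta> x"
proof -
  show "g x \<xi> = \<eta> x" using g_phi_phi[of x \<xi>] assms by simp
  then show "g \<xi> x = \<eta> x" using g_sym[of x \<xi>] assms by simp
qed

lemma g_phi_left [simp]:
  assumes "x \<in> VF M" "y \<in> VF M"
  shows "g (\<phi> x) y = g x (\<phi> y)"
  using g_phi_phi[of x "\<phi> y"] assms by (simp add: phi_phi)

lemma g_phi_phi_right [simp]:
  assumes "x \<in> VF M" "y \<in> VF M"
  shows "g x (\<phi> (\<phi> y)) = \<eta> x * \<eta> y - g x y"
  using assms g_phi_phi by simp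

section \<open>Frames and nondegeneracy\<close>

lemma orthonormal_frame:
  obtains e where "frame_at (charts M) p (2 * n + 1) e"
    and "\<And>i. i < 2 * n + 1 \<Longrightarrow> e i \<in> VF M"
    and "\<And>i j. i < 2 * n + 1 \<Longrightarrow> j < 2 * n + 1 \<Longrightarrow> i \<noteq> j \<Longrightarrow> g (e i) (e j) p = 0"
    and "\<And>i. i < 2 * n + 1 \<Longrightarrow> g (e i) (e i) p \<noteq> 0"
proof -
  have "n + (n + 1) = 2 * n + 1" by simp
  with acB obtain e where e: "frame_at (charts M) p (2 * n + 1) e"
    "\<forall>i<2 * n + 1. \<forall>j<2 * n + 1. g (e i) (e j) p = (if i \<noteq> j then 0 else if i < n then - 1 else 1)"
    unfolding almost_contact_B_metric_def pseudo_metric_def by metis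
  show thesis by (rule that[OF e(1)]) (use e in \<open>auto simp: frame_at_def\<close>)
qed

lemma frame_exists: "\<exists>b. frame_at (charts M) q (2 * n + 1) b"
  using orthonormal_frame by metis

lemma one_form_at_zero:
  "one_form (charts M) \<omega> \<Longrightarrow> x \<in> VF M \<Longrightarrow> (\<And>h. x h p = 0) \<Longrightarrow> \<omega> x p = 0"
  using one_form_local[OF atlas frame_exists] by blast

text \<open>Nondegeneracy is part of the hypotheses only for the Gram matrix of a frame at each point. It
  passes to vector fields because \<open>r\<close> and its expansion in the frame at \<open>p\<close>, with constant
  coefficients, have the same value at \<open>p\<close> and therefore the same inner products there.\<close>

lemma g_nondegenerate:
  assumes r: "r \<in> VF M" and zero: "\<And>x. x \<in> VF M \<Longrightarrow> g x r = 0"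
  shows "r = 0"
proof -
  have "r h p = 0" for h p
  proof -
    obtain e where fr: "frame_at (charts M) p (2 * n + 1) e"
      and e: "\<And>i. i < 2 * n + 1 \<Longrightarrow> e i \<in> VF M"
      and ortho: "\<And>i j. i < 2 * n + 1 \<Longrightarrow> j < 2 * n + 1 \<Longrightarrow> i \<noteq> j \<Longrightarrow> g (e i) (e j) p = 0"
      and norm: "\<And>i. i < 2 * n + 1 \<Longrightarrow> g (e i) (e i) p \<noteq> 0"
      using orthonormal_frame by blast
    have "\<forall>v\<in>tangent_space (charts M) p. \<exists>c. \<forall>h. v h = (\<Sum>i<2 * n + 1. c i * e i h p)"
      using fr by (simp add: frame_at_def)
    from bspec[OF this vfields_imp_tangent[OF r]]
    obtain c where c: "\<And>h. r h p = (\<Sum>i<2 * n + 1. c i * e i h p)" by blast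
    define s where "s = r - (\<Sum>i<2 * n + 1. (\<lambda>_. c i) \<cdot> e i)"
    have sum: "(\<Sum>i<2 * n + 1. (\<lambda>_. c i) \<cdot> e i) \<in> VF M"
      using e by (intro vfields_sum atlas) auto
    have "c j = 0" if j: "j < 2 * n + 1" for j
    proof -
      have "g (e j) s p = 0"
        by (rule one_form_at_zero[OF one_form_g[OF e[OF j]]])
          (use r sum c in \<open>auto simp: s_def sum_fun_apply simp del: sum.lessThan_Suc\<close>)
      moreover have "g (e j) s p = - (\<Sum>i<2 * n + 1. c i * g (e j) (e i) p)"
      proof -
        have "g (e j) (\<Sum>i<2 * n + 1. (\<lambda>_. c i) \<cdot> e i) = (\<Sum>i<2 * n + 1. g (e j) ((\<lambda>_. c i) \<cdot> e i))"
          by (rule one_form_sum[OF atlas one_form_g[OF e[OF j]]]) (simp add: e)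
        also have "\<dots> = (\<Sum>i<2 * n + 1. (\<lambda>_. c i) * g (e j) (e i))"
          using e[OF j] e by (intro sum.cong) auto
        finally show ?thesis
          using r e[OF j] sum zero[OF e[OF j]] unfolding s_def
          by (simp add: sum_fun_apply del: sum.lessThan_Suc)
      qed
      moreover have "(\<Sum>i<2 * n + 1. c i * g (e j) (e i) p) = c j * g (e j) (e j) p"
        using j ortho by (subst sum.remove[of _ j]) (auto intro!: sum.neutral)
      ultimately show ?thesis using norm[OF j] by (simp del: sum.lessThan_Suc)
    qed
    then show ?thesis using c by (simp del: sum.lessThan_Suc)
  qed
  then show ?thesis by (simp add: fun_eq_iff)
qed

text \<open>The traces are defined by choosing an adapted basis, so they are meaningful only because one
  exists. Take any frame, exchange one of its members for \<open>\<xi>\<close>, and remove the \<open>\<xi>\<close>-components of the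
  others.\<close>

lemma adapted_basis_exists: "\<exists>e. adapted_basis n M p e"
proof -
  obtain b where b: "frame_at (charts M) p (2 * n + 1) b" using frame_exists by blast
  have bV: "b i \<in> VF M" if "i < 2 * n + 1" for i using b that by (simp add: frame_at_def)
  have indep: "\<forall>i<2 * n + 1. c i = 0" if "\<forall>h. (\<Sum>i<2 * n + 1. c i * b i h p) = 0" for c
    using b that unfolding frame_at_def by blast
  have "\<forall>v\<in>tangent_space (charts M) p. \<exists>c. \<forall>h. v h = (\<Sum>i<2 * n + 1. c i * b i h p)"
    using b by (simp add: frame_at_def)
  from bspec[OF this vfields_imp_tangent[OF VF_closed(1)]]
  obtain d where d: "\<And>h. \<xi> h p = (\<Sum>i<2 * n + 1. d i * b i h p)" by blast
  have "\<exists>k<2 * n + 1. d k \<noteq> 0"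
  proof (rule ccontr)
    assume "\<not> ?thesis"
    then have "\<xi> h p = 0" for h by (simp add: d del: sum.lessThan_Suc)
    then have "\<eta> \<xi> p = 0" by (rule one_form_at_zero[OF one_form_eta VF_closed(1)])
    then show False by simp
  qed
  then obtain k where k: "k < 2 * n + 1" "d k \<noteq> 0" by blast
  \<comment> \<open>\<open>\<xi>\<close> replaces the basis vector with index \<open>k\<close>, which is moved to the last position.\<close>
  define \<sigma> where "\<sigma> = Transposition.transpose k (2 * n)"
  have bij: "bij_betw \<sigma> {..<2 * n + 1} {..<2 * n + 1}"
    unfolding \<sigma>_def using k by (intro bij_betw_transpose_iff) auto
  have \<sigma>N: "\<sigma> i < 2 * n + 1" if "i < 2 * n + 1" for i
    using bij that by (auto simp: bij_betw_def)
  have \<sigma>\<sigma>: "\<sigma> (\<sigma> i) = i" for i by (simp add: \<sigma>_def)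
  have b\<sigma>V: "b (\<sigma> i) \<in> VF M" if "i < 2 * n + 1" for i using bV[OF \<sigma>N[OF that]] .
  define e where "e i = b (\<sigma> i) - (\<lambda>_. \<eta> (b (\<sigma> i)) p) \<cdot> \<xi>" for i
  have frame: "frame_at (charts M) p (2 * n + 1) (\<lambda>i. if i < 2 * n then e i else \<xi>)"
  proof (rule frame_atI_independent[OF b])
    fix i assume "i < 2 * n + 1"
    then show "(if i < 2 * n then e i else \<xi>) \<in> VF M" by (simp add: e_def b\<sigma>V)
  next
    fix c assume "\<And>h. (\<Sum>i<2 * n + 1. c i * (if i < 2 * n then e i else \<xi>) h p) = 0"
    then have rel: "(\<Sum>i<2 * n. c i * e i h p) + c (2 * n) * \<xi> h p = 0" for h by simp
    \<comment> \<open>\<open>K\<close> is the total coefficient of \<open>\<xi>\<close>. Expanding \<open>\<xi>\<close> by the coefficients \<open>d\<close> gives a relation \<open>c'\<close>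
      between the original frame vectors.\<close>
    define K where "K = c (2 * n) - (\<Sum>i<2 * n. c i * \<eta> (b (\<sigma> i)) p)"
    define c' where "c' i = (if i < 2 * n then c i else 0) + K * d (\<sigma> i)" for i
    have "(\<Sum>i<2 * n + 1. c' i * b (\<sigma> i) h p) = 0" for h
    proof -
      have "(\<Sum>i<2 * n + 1. c' i * b (\<sigma> i) h p) =
          (\<Sum>i<2 * n. c i * b (\<sigma> i) h p) + K * (\<Sum>i<2 * n + 1. d (\<sigma> i) * b (\<sigma> i) h p)"
        by (simp add: c'_def algebra_simps sum.distrib sum_distrib_left)
      also have "(\<Sum>i<2 * n + 1. d (\<sigma> i) * b (\<sigma> i) h p) = \<xi> h p"
        unfolding d by (rule sum.reindex_bij_betw[OF bij])
      also have "(\<Sum>i<2 * n. c i * b (\<sigma> i) h p) + K * \<xi> h p = 0"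
        using rel[of h]
        by (simp add: e_def K_def algebra_simps sum_subtractf sum_distrib_left sum_distrib_right)
      finally show ?thesis .
    qed
    moreover have "(\<Sum>i<2 * n + 1. c' i * b (\<sigma> i) h p) = (\<Sum>i<2 * n + 1. c' (\<sigma> i) * b i h p)" for h
      using sum.reindex_bij_betw[OF bij, of "\<lambda>i. c' (\<sigma> i) * b i h p"] by (simp only: \<sigma>\<sigma>)
    ultimately have "\<forall>h. (\<Sum>i<2 * n + 1. c' (\<sigma> i) * b i h p) = 0" by metis
    then have "\<forall>i<2 * n + 1. c' (\<sigma> i) = 0" by (rule indep)
    then have c'0: "c' i = 0" if "i < 2 * n + 1" for i
      using \<sigma>N[OF that] \<sigma>\<sigma>[of i] by metis
    have "K * d k = 0" using c'0[of "2 * n"] by (simp add: c'_def \<sigma>_def)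
    then have "K = 0" using k by simp
    then have "c i = 0" if "i < 2 * n" for i using c'0[of i] that by (simp add: c'_def)
    moreover from this have "c (2 * n) = 0" using \<open>K = 0\<close> by (simp add: K_def)
    ultimately show "\<forall>i<2 * n + 1. c i = 0" by (auto simp: less_Suc_eq)
  qed
  have "\<forall>i<2 * n. \<eta> (e i) p = 0" by (simp add: e_def b\<sigma>V)
  with frame show ?thesis unfolding adapted_basis_def by blast
qed

section \<open>The Lee forms\<close>

text \<open>Differentiate \<open>\<phi> (\<phi> y) = - y + \<eta> y \<cdot> \<xi>\<close>, and move \<open>\<phi>\<close> across \<open>g\<close>.\<close>

lemma F_phi_phi:
  assumes D: "linear_connection (charts M) D" and V: "x \<in> VF M" "y \<in> VF M" "z \<in> VF M"
  shows "F_tensor M D x (\<phi> y) (\<phi> z) =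
    F_tensor M D x y z - \<eta> y * F_tensor M D x \<xi> z - \<eta> z * F_tensor M D x y \<xi>"
proof -
  have DV: "D x u \<in> VF M" if "u \<in> VF M" for u
    using D V that by (simp add: linear_connection_def)
  have Dadd: "D x (u + w) = D x u + D x w" if "u \<in> VF M" "w \<in> VF M" for u w
    using D V that by (simp add: linear_connection_def)
  have Dmult: "D x (f \<cdot> u) = f \<cdot> D x u + x f \<cdot> u" if "u \<in> VF M" "f \<in> S" for u f
    using D V that by (simp add: linear_connection_def)
  have D0: "D x 0 = 0" using Dadd[of 0 0] by simp
  have "D x (\<phi> (\<phi> y)) = D x ((\<lambda>_. - 1) \<cdot> y) + D x (\<eta> y \<cdot> \<xi>)"
    using V by (simp add: phi_phi uminus_vfield_eq Dadd)
  also have "\<dots> = - D x y + (\<eta> y \<cdot> D x \<xi> + x (\<eta> y) \<cdot> \<xi>)"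
    using V by (simp add: Dmult vfields_const_fun) (simp add: fun_eq_iff)
  finally have DD: "D x (\<phi> (\<phi> y)) = - D x y + (\<eta> y \<cdot> D x \<xi> + x (\<eta> y) \<cdot> \<xi>)" .
  have "x (\<eta> y) \<in> S" using V by (simp add: vfields_smooth)
  then show ?thesis
    using V by (simp add: F_tensor_def DD D0 DV fun_eq_iff algebra_simps)
qed

text \<open>On a horizontal basis the term with \<open>\<eta> y\<close> in \<open>F_phi_phi\<close> vanishes, so this holds summand by
  summand, whatever the matrix \<open>g\<^sup>i\<^sup>j\<close>.\<close>

lemma theta_star_phi:
  assumes D: "linear_connection (charts M) D" and z: "z \<in> VF M"
  shows "theta_star n M D (\<phi> z) = - theta n M D (\<phi> (\<phi> z))"
proof
  fix p
  define e where "e = (SOME e. adapted_basis n M p e)"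
  define G where "G = inverse_metric n M p e"
  have "adapted_basis n M p e"
    unfolding e_def using adapted_basis_exists by (rule someI_ex)
  then have eV: "e i \<in> VF M" and eta: "\<eta> (e i) p = 0" if "i < 2 * n" for i
    using that unfolding adapted_basis_def frame_at_def by (auto split: if_splits)
  have "F_tensor M D (e i) (\<phi> (e j)) (\<phi> z) p = - F_tensor M D (e i) (e j) (\<phi> (\<phi> z)) p"
    if "i < 2 * n" "j < 2 * n" for i j
  proof -
    have "D (e i) (\<phi> (e j)) \<in> VF M" "D (e i) (e j) \<in> VF M"
      using D eV that by (simp_all add: linear_connection_def)
    then show ?thesis
      using that z F_phi_phi[OF D eV[of i] eV[of j] z] eV eta
      by (simp add: F_tensor_def phi_phi)
  qed
  then have "(\<Sum>i<2 * n. \<Sum>j<2 * n. G i j * F_tensor M D (e i) (\<phi> (e j)) (\<phi> z) p) =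
      - (\<Sum>i<2 * n. \<Sum>j<2 * n. G i j * F_tensor M D (e i) (e j) (\<phi> (\<phi> z)) p)"
    by (simp flip: sum_negf)
  then show "theta_star n M D (\<phi> z) p = (- theta n M D (\<phi> (\<phi> z))) p"
    by (simp add: theta_star_def theta_def Let_def e_def G_def)
qed

text \<open>Hence \<open>\<phi> a\<^sup>* = - \<phi>\<^sup>2 a\<close>: the horizontal parts of \<open>a\<close> and \<open>a\<^sup>*\<close> determine each other.\<close>

lemma phi_dual_theta_star:
  assumes D: "linear_connection (charts M) D"
    and a: "metric_dual M (theta n M D) a" and as: "metric_dual M (theta_star n M D) as"
    and x: "x \<in> VF M"
  shows "g x (\<phi> as) = g x a - \<eta> x * \<eta> a"
  using theta_star_phi[OF D x] a as x by (simp add: metric_dual_def)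

lemma phi_dual_theta:
  assumes "linear_connection (charts M) D"
    and "metric_dual M (theta n M D) a" and "metric_dual M (theta_star n M D) as"
    and x: "x \<in> VF M"
  shows "g x (\<phi> a) = \<eta> x * \<eta> as - g x as"
  using phi_dual_theta_star[OF assms(1-3), of "\<phi> x"] assms(2,3) x by (simp add: metric_dual_def)

text \<open>\<open>\<eta>\<close> of the dual field is \<open>F \<xi> \<xi> \<xi>\<close>, and \<open>(D\<^sub>\<xi> \<phi>) \<xi> = - \<phi> (D\<^sub>\<xi> \<xi>)\<close> is horizontal.\<close>

lemma eta_dual_omega:
  assumes D: "linear_connection (charts M) D" and ah: "metric_dual M (omega M D) ah"
  shows "\<eta> ah = 0"
proof -
  have DV: "D \<xi> \<xi> \<in> VF M" using D by (simp add: linear_connection_def)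
  have "D \<xi> (0 + 0) = D \<xi> 0 + D \<xi> 0"
    using D VF_closed(1,6) unfolding linear_connection_def by blast
  then have "D \<xi> 0 = 0" by simp
  have "\<eta> ah = omega M D \<xi>" using ah by (simp add: metric_dual_def)
  also have "\<dots> = 0" using DV \<open>D \<xi> 0 = 0\<close> by (simp add: omega_def F_tensor_def)
  finally show ?thesis .
qed

section \<open>The torsion tensors\<close>

lemma g_phi_sym: "x \<in> VF M \<Longrightarrow> y \<in> VF M \<Longrightarrow> g x (\<phi> y) = g y (\<phi> x)"
  using g_phi_left[of x y] g_sym[of "\<phi> x" y] by simp

lemma lower_add:
  assumes "P x y z \<in> VF M" "Q x y z \<in> VF M" "w \<in> VF M"
  shows "lower M (P + Q) x y z w = lower M P x y z w + lower M Q x y z w"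
  using assms by (simp add: lower_def)

lemma pi_VF [simp]:
  assumes "x \<in> VF M" "y \<in> VF M" "z \<in> VF M"
  shows "pi1 M x y z \<in> VF M" "pi2 M x y z \<in> VF M" "pi3 M x y z \<in> VF M"
    "pi4 M x y z \<in> VF M" "pi5 M x y z \<in> VF M"
  using assms by (simp_all add: pi1_def pi2_def pi3_def pi4_def pi5_def swap_diff_def)

lemma lower_pi:
  assumes "x \<in> VF M" "y \<in> VF M" "z \<in> VF M" "w \<in> VF M"
  shows lower_pi1: "lower M (pi1 M) x y z w = g y z * g x w - g x z * g y w"
    and lower_pi2: "lower M (pi2 M) x y z w = g y (\<phi> z) * g x (\<phi> w) - g x (\<phi> z) * g y (\<phi> w)"
    and lower_pi3: "lower M (pi3 M) x y z w =
      g x z * g y (\<phi> w) + g x (\<phi> z) * g y w - g y z * g x (\<phi> w) - g y (\<phi> z) * g x w"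
    and lower_pi4: "lower M (pi4 M) x y z w =
      \<eta> y * \<eta> z * g x w + g y z * \<eta> x * \<eta> w - \<eta> x * \<eta> z * g y w - g x z * \<eta> y * \<eta> w"
    and lower_pi5: "lower M (pi5 M) x y z w =
      \<eta> y * \<eta> z * g x (\<phi> w) + g y (\<phi> z) * \<eta> x * \<eta> w
      - \<eta> x * \<eta> z * g y (\<phi> w) - g x (\<phi> z) * \<eta> y * \<eta> w"
  using assms
  by (simp_all add: lower_def pi1_def pi2_def pi3_def pi4_def pi5_def swap_diff_def algebra_simps)

text \<open>The part \<open>\<pi>\<^sub>3 + \<pi>\<^sub>5\<close> of the torsion, through which alone the parameters of the family enter.\<close>

definition pi35 where "pi35 r x y z = lower M (pi3 M + pi5 M) x y z r"

text \<open>For a horizontal \<open>r\<close> the tensor sees only the horizontal parts of its arguments. The summand \<open>\<pi>\<^sub>5\<close>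
  serves to turn \<open>g\<close> into its horizontal part \<open>g - \<eta> \<otimes> \<eta>\<close>.\<close>

lemma pi35_eq:
  assumes "x \<in> VF M" "y \<in> VF M" "z \<in> VF M" "r \<in> VF M" "\<eta> r = 0"
  shows "pi35 r x y z =
    (g x z - \<eta> x * \<eta> z) * g y (\<phi> r) + g x (\<phi> z) * g y r
    - (g y z - \<eta> y * \<eta> z) * g x (\<phi> r) - g y (\<phi> z) * g x r"
  using assms by (simp add: pi35_def lower_add lower_pi3 lower_pi5 algebra_simps)

lemma canonical_defect_cong:
  assumes "\<And>u v w. u \<in> VF M \<Longrightarrow> v \<in> VF M \<Longrightarrow> w \<in> VF M \<Longrightarrow> T u v w = T' u v w"
    and "x \<in> VF M" "y \<in> VF M" "z \<in> VF M"
  shows "canonical_defect M T x y z = canonical_defect M T' x y z"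
  using assms(2-4) by (simp add: canonical_defect_def swap_diff_def assms(1))

lemma canonical_defect_add:
  "canonical_defect M (\<lambda>x y z. T x y z + T' x y z) x y z =
   canonical_defect M T x y z + canonical_defect M T' x y z"
  by (simp add: canonical_defect_def swap_diff_def algebra_simps)

text \<open>Write \<open>P\<close> for the tensor. It is horizontal and \<open>P x (\<phi> y) (\<phi> z) = - P x y z\<close>, so the defect is
  \<open>2 (P x y z - P x z y)\<close>; as \<open>P\<close> is skew in its first two arguments and has vanishing cyclic sum,
  this is \<open>- 2 P y z x\<close>. In particular the defect of \<open>P\<close> vanishes only if \<open>P\<close> does.\<close>

lemma canonical_defect_pi35:
  assumes V: "x \<in> VF M" "y \<in> VF M" "z \<in> VF M" "r \<in> VF M" "\<eta> r = 0"
  shows "canonical_defect M (pi35 r) x y z = - (2 * pi35 r y z x)"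
proof -
  have sym: "g z y = g y z" "g y x = g x y" "g z x = g x z"
    "g z (\<phi> y) = g y (\<phi> z)" "g y (\<phi> x) = g x (\<phi> y)" "g z (\<phi> x) = g x (\<phi> z)"
    using V by (auto intro: g_sym g_phi_sym)
  have "\<eta> (\<phi> r) = 0" using V by simp
  then show ?thesis
    unfolding canonical_defect_def swap_diff_def
    using V by (simp add: pi35_eq sym fun_eq_iff algebra_simps)
qed

text \<open>On horizontal arguments, with \<open>A = g(\<cdot>, a\<^sup>*)\<close>, the tensor \<open>T = \<pi>\<^sub>1 + \<pi>\<^sub>2\<close> satisfies
  \<open>T x y z - T x (\<phi> y) (\<phi> z) = 2 (g y z A x + g y (\<phi> z) A (\<phi> x))\<close>, which is symmetric in \<open>y\<close> and
  \<open>z\<close>. The remaining terms involve \<open>\<eta>\<close> and cancel by direct expansion.\<close>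

lemma canonical_defect_canonical_torsion:
  assumes V: "x \<in> VF M" "y \<in> VF M" "z \<in> VF M" "a \<in> VF M" "as \<in> VF M" "ah \<in> VF M"
    and a: "\<And>x. x \<in> VF M \<Longrightarrow> g x (\<phi> a) = \<eta> x * \<eta> as - g x as"
    and as: "\<And>x. x \<in> VF M \<Longrightarrow> g x (\<phi> as) = g x a - \<eta> x * \<eta> a"
    and ah: "\<eta> ah = 0"
  shows "canonical_defect M (canonical_torsion n M a as ah) x y z = 0"
proof -
  have sym: "g z y = g y z" "g y x = g x y" "g z x = g x z"
    "g z (\<phi> y) = g y (\<phi> z)" "g y (\<phi> x) = g x (\<phi> y)" "g z (\<phi> x) = g x (\<phi> z)"
    using V(1-3) by (auto intro: g_sym g_phi_sym)
  have T: "canonical_torsion n M a as ah u v w = (\<lambda>_. 1 / (4 * real n)) *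
      (g v w * g u as - g u w * g v as + (g v (\<phi> w) * (g u a - \<eta> u * \<eta> a) - g u (\<phi> w) * (g v a - \<eta> v * \<eta> a))
       + (\<eta> v * \<eta> w * g u as + g v w * \<eta> u * \<eta> as - \<eta> u * \<eta> w * g v as - g u w * \<eta> v * \<eta> as))
    + (\<lambda>_. 1 / (2 * real n)) * (\<eta> v * \<eta> w * (\<eta> u * \<eta> as - g u as) + g v (\<phi> w) * \<eta> u * \<eta> a
      - \<eta> u * \<eta> w * (\<eta> v * \<eta> as - g v as) - g u (\<phi> w) * \<eta> v * \<eta> a)
    - (\<eta> v * \<eta> w * g u (\<phi> ah) - \<eta> u * \<eta> w * g v (\<phi> ah))"
    if "u \<in> VF M" "v \<in> VF M" "w \<in> VF M" for u v w
    using that V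
    by (simp add: canonical_torsion_def lower_add lower_pi a as ah algebra_simps)
  show ?thesis
    unfolding canonical_defect_def swap_diff_def
    using V by (simp add: T sym a as ah) (simp add: fun_eq_iff field_simps sym)
qed

lemma q_field_VF [simp]:
  "a \<in> VF M \<Longrightarrow> as \<in> VF M \<Longrightarrow> ah \<in> VF M \<Longrightarrow> q_field M a as ah \<alpha>1 \<alpha>2 \<alpha>3 \<alpha>4 \<in> VF M"
  by (simp add: q_field_def)

lemma q_field_inner:
  assumes "x \<in> VF M" "a \<in> VF M" "as \<in> VF M" "ah \<in> VF M"
  shows g_q_field: "g x (q_field M a as ah \<alpha>1 \<alpha>2 \<alpha>3 \<alpha>4) =
      (\<lambda>_. \<alpha>1) * (\<eta> x * \<eta> as - g x as) - (\<lambda>_. \<alpha>2) * (\<eta> x * \<eta> a - g x a)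
      - (\<lambda>_. \<alpha>3) * g x (\<phi> ah) + (\<lambda>_. \<alpha>4) * g x ah"
    and g_phi_q_field: "g x (\<phi> (q_field M a as ah \<alpha>1 \<alpha>2 \<alpha>3 \<alpha>4)) =
      - (\<lambda>_. \<alpha>1) * g x (\<phi> as) + (\<lambda>_. \<alpha>2) * g x (\<phi> a)
      - (\<lambda>_. \<alpha>3) * (\<eta> x * \<eta> ah - g x ah) + (\<lambda>_. \<alpha>4) * g x (\<phi> ah)"
    and eta_q_field: "\<eta> (q_field M a as ah \<alpha>1 \<alpha>2 \<alpha>3 \<alpha>4) = (\<lambda>_. \<alpha>4) * \<eta> ah"
proof -
  have q: "g x (q_field M a as ah \<alpha>1 \<alpha>2 \<alpha>3 \<alpha>4) =
      (\<lambda>_. \<alpha>1) * (\<eta> x * \<eta> as - g x as) - (\<lambda>_. \<alpha>2) * (\<eta> x * \<eta> a - g x a)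
      - (\<lambda>_. \<alpha>3) * g x (\<phi> ah) + (\<lambda>_. \<alpha>4) * g x ah" if "x \<in> VF M" for x
    using assms that by (simp add: q_field_def)
  show "g x (q_field M a as ah \<alpha>1 \<alpha>2 \<alpha>3 \<alpha>4) =
      (\<lambda>_. \<alpha>1) * (\<eta> x * \<eta> as - g x as) - (\<lambda>_. \<alpha>2) * (\<eta> x * \<eta> a - g x a)
      - (\<lambda>_. \<alpha>3) * g x (\<phi> ah) + (\<lambda>_. \<alpha>4) * g x ah" by (rule q[OF assms(1)])
  show "g x (\<phi> (q_field M a as ah \<alpha>1 \<alpha>2 \<alpha>3 \<alpha>4)) =
      - (\<lambda>_. \<alpha>1) * g x (\<phi> as) + (\<lambda>_. \<alpha>2) * g x (\<phi> a)
      - (\<lambda>_. \<alpha>3) * (\<eta> x * \<eta> ah - g x ah) + (\<lambda>_. \<alpha>4) * g x (\<phi> ah)"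
    using q[of "\<phi> x"] assms by (simp add: fun_eq_iff)
  show "\<eta> (q_field M a as ah \<alpha>1 \<alpha>2 \<alpha>3 \<alpha>4) = (\<lambda>_. \<alpha>4) * \<eta> ah"
    using assms by (simp add: q_field_def)
qed

lemma family_torsion_eq:
  fixes \<alpha>1 \<alpha>2 \<alpha>3 \<alpha>4 \<beta> :: real
  assumes V: "x \<in> VF M" "y \<in> VF M" "z \<in> VF M" "a \<in> VF M" "as \<in> VF M" "ah \<in> VF M"
  shows "family_torsion n M a as ah \<alpha>1 \<alpha>2 \<alpha>3 \<alpha>4 x y z =
    family_torsion n M a as ah 0 \<beta> 0 0 x y z + pi35 (q_field M a as ah \<alpha>1 (\<alpha>2 - \<beta>) \<alpha>3 \<alpha>4) x y z"
  using assms
  by (simp add: family_torsion_def q_field_inner lower_add lower_pi pi35_def)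
    (simp add: fun_eq_iff algebra_simps)

text \<open>Here \<open>q = \<phi> a\<^sup>* / (4 n)\<close>, and \<open>\<pi>\<^sub>3 + \<pi>\<^sub>5\<close> evaluated on \<open>\<phi> a\<^sup>*\<close> is \<open>\<pi>\<^sub>1 - \<pi>\<^sub>2 - \<pi>\<^sub>4\<close> evaluated on \<open>a\<^sup>*\<close>.\<close>

lemma family_torsion_eq_canonical_torsion:
  assumes V: "x \<in> VF M" "y \<in> VF M" "z \<in> VF M" "a \<in> VF M" "as \<in> VF M" "ah \<in> VF M"
    and a: "\<And>x. x \<in> VF M \<Longrightarrow> g x (\<phi> a) = \<eta> x * \<eta> as - g x as"
    and as: "\<And>x. x \<in> VF M \<Longrightarrow> g x (\<phi> as) = g x a - \<eta> x * \<eta> a"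
    and ah: "\<eta> ah = 0"
  shows "family_torsion n M a as ah 0 (1 / (4 * real n)) 0 0 x y z = canonical_torsion n M a as ah x y z"
  using V
  by (simp add: family_torsion_def canonical_torsion_def q_field_inner lower_add lower_pi a as ah)
    (simp add: fun_eq_iff field_simps)

text \<open>At a point \<open>p\<close> the functionals \<open>\<eta>\<close>, \<open>g(\<cdot>, r)\<close> and \<open>g(\<cdot>, \<phi> r)\<close> have a common kernel vector \<open>y\<close>, as the
  dimension \<open>2 n + 1\<close> exceeds 3; for \<open>n = 1\<close> there need not be one. For this \<open>y\<close> the relation reduces to
  \<open>g y z g x (\<phi> r) + g y (\<phi> z) g x r = 0\<close>. Together with its instance at \<open>\<phi> z\<close> it is a linear system
  for \<open>g x (\<phi> r)\<close> and \<open>g x r\<close> with determinant \<open>- (g y z)\<^sup>2 - (g y (\<phi> z))\<^sup>2\<close>, which is nonzero for a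
  suitable \<open>z\<close>.\<close>

lemma pi35_eq_0_imp_eq_0:
  assumes n: "n \<ge> 2" and r: "r \<in> VF M" "\<eta> r = 0"
    and zero: "\<And>x y z. x \<in> VF M \<Longrightarrow> y \<in> VF M \<Longrightarrow> z \<in> VF M \<Longrightarrow> pi35 r x y z = 0"
  shows "r = 0"
proof (rule g_nondegenerate[OF r(1)], rule ext)
  fix x p assume x: "x \<in> VF M"
  obtain e where "frame_at (charts M) p (2 * n + 1) e"
    and e: "\<And>i. i < 2 * n + 1 \<Longrightarrow> e i \<in> VF M"
    and ortho: "\<And>i j. i < 2 * n + 1 \<Longrightarrow> j < 2 * n + 1 \<Longrightarrow> i \<noteq> j \<Longrightarrow> g (e i) (e j) p = 0"
    and norm: "\<And>i. i < 2 * n + 1 \<Longrightarrow> g (e i) (e i) p \<noteq> 0"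
    using orthonormal_frame by blast
  define w where "w j = (if j = 0 then \<xi> else if j = 1 then r else \<phi> r)" for j :: nat
  have w: "w j \<in> VF M" for j using r by (simp add: w_def)
  have "3 < 2 * n + 1" using n by simp
  from underdetermined_system[OF this, of "\<lambda>i j. g (e i) (w j) p"]
  obtain c where c: "\<exists>i<2 * n + 1. c i \<noteq> 0"
      "\<forall>j<3. (\<Sum>i<2 * n + 1. c i * g (e i) (w j) p) = 0" by blast
  then obtain k where k: "k < 2 * n + 1" "c k \<noteq> 0" by blast
  define y where "y = (\<Sum>i<2 * n + 1. (\<lambda>_. c i) \<cdot> e i)"
  have y: "y \<in> VF M" unfolding y_def using e by (intro vfields_sum atlas) simp
  have gy: "g y w p = (\<Sum>i<2 * n + 1. c i * g (e i) w p)" if w: "w \<in> VF M" for w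
  proof -
    have "g y w = g w y" using y w by (rule g_sym)
    also have "\<dots> = (\<Sum>i<2 * n + 1. g w ((\<lambda>_. c i) \<cdot> e i))"
      unfolding y_def by (rule one_form_sum[OF atlas one_form_g[OF w]]) (simp add: e)
    also have "\<dots> = (\<Sum>i<2 * n + 1. (\<lambda>_. c i) * g (e i) w)"
      using w e by (intro sum.cong refl) (simp add: g_sym[OF w e])
    finally show ?thesis by (simp only: sum_fun_apply times_fun_apply)
  qed
  have "g y (w j) p = 0" if "j < 3" for j using c(2) that by (simp only: gy[OF w])
  from this[of 0] this[of 1] this[of 2]
  have ker: "\<eta> y p = 0" "g y r p = 0" "g y (\<phi> r) p = 0" using y by (simp_all add: w_def)
  have yk: "g y (e k) p \<noteq> 0"
  proof -
    have "g y (e k) p = c k * g (e k) (e k) p"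
      unfolding gy[OF e[OF k(1)]] using k(1) ortho
      by (subst sum.remove[of _ k]) (auto intro!: sum.neutral)
    then show ?thesis using k norm by simp
  qed
  \<comment> \<open>In the direction of \<open>y\<close> only the terms without \<open>\<eta> y\<close>, \<open>g y r\<close> and \<open>g y (\<phi> r)\<close> survive.\<close>
  have rel: "g y v p * g x (\<phi> r) p + g y (\<phi> v) p * g x r p = 0" if v: "v \<in> VF M" for v
  proof -
    have "pi35 r x y v p = - (g y v p * g x (\<phi> r) p + g y (\<phi> v) p * g x r p)"
      using ker by (simp add: pi35_eq[OF x y v r])
    then show ?thesis using zero[OF x y v] by simp
  qed
  have "g y (e k) p * g x (\<phi> r) p + g y (\<phi> (e k)) p * g x r p = 0"
    using rel e[OF k(1)] by simp
  moreover have "g y (\<phi> (e k)) p * g x (\<phi> r) p - g y (e k) p * g x r p = 0"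
    using rel[of "\<phi> (e k)"] e[OF k(1)] y ker by simp
  moreover have "(A\<^sup>2 + B\<^sup>2) * Q = 0" if "A * P + B * Q = 0" "B * P - A * Q = 0" for A B P Q :: real
  proof -
    have "(A\<^sup>2 + B\<^sup>2) * Q = B * (A * P + B * Q) - A * (B * P - A * Q)"
      by (simp add: power2_eq_square algebra_simps)
    then show ?thesis using that by simp
  qed
  ultimately have "((g y (e k) p)\<^sup>2 + (g y (\<phi> (e k)) p)\<^sup>2) * g x r p = 0" by blast
  then show "g x r p = 0 p" using yk by (simp add: sum_power2_eq_zero_iff)
qed

end

section \<open>The \<open>\<phi>\<close>-canonical connection in the family\<close>

theorem theorem3p1:
  fixes n :: nat
    and M :: "('m::{t2_space,second_countable_topology}, 'e::euclidean_space) acb_structure"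
    and nabla D :: "'m vfield \<Rightarrow> 'm vfield \<Rightarrow> 'm vfield"
    and a as ah :: "'m vfield"
    and \<alpha>1 \<alpha>2 \<alpha>3 \<alpha>4 :: real
  assumes "n \<ge> 1"
    and "almost_contact_B_metric n M"
    and "levi_civita (charts M) (bmetric M) nabla"
    and "class_F1_F4_F5_F11 n M nabla"
    and "metric_dual M (theta n M nabla) a"
    and "metric_dual M (theta_star n M nabla) as"
    and "metric_dual M (omega M nabla) ah"
    and "natural_connection M D"
    and "\<forall>x\<in>VF M. \<forall>y\<in>VF M. \<forall>z\<in>VF M.
           torsion3 M D x y z = family_torsion n M a as ah \<alpha>1 \<alpha>2 \<alpha>3 \<alpha>4 x y z"
  shows "(n \<ge> 2 \<and> independent_parameters M a as ah \<longrightarrow>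
         (phi_canonical M D \<longleftrightarrow> \<alpha>1 = 0 \<and> \<alpha>3 = 0 \<and> \<alpha>4 = 0 \<and> \<alpha>2 = 1 / (4 * real n)))
    \<and> (\<alpha>1 = 0 \<and> \<alpha>3 = 0 \<and> \<alpha>4 = 0 \<and> \<alpha>2 = 1 / (4 * real n) \<longrightarrow> phi_canonical M D)
    \<and> (phi_canonical M D \<longleftrightarrow>
         (\<forall>x\<in>VF M. \<forall>y\<in>VF M. \<forall>z\<in>VF M.
            torsion3 M D x y z = family_torsion n M a as ah 0 (1 / (4 * real n)) 0 0 x y z))
    \<and> (phi_canonical M D \<longrightarrow>
         (\<forall>x\<in>VF M. \<forall>y\<in>VF M. \<forall>z\<in>VF M.
            torsion3 M D x y z = canonical_torsion n M a as ah x y z))"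
proof -
  interpret almost_contact_B_manifold n M
    by (rule almost_contact_B_manifold.intro) (rule assms(2))
  have nabla: "linear_connection (charts M) nabla" using assms(3) by (simp add: levi_civita_def)
  have V: "a \<in> VF M" "as \<in> VF M" "ah \<in> VF M"
    using assms(5-7) by (simp_all add: metric_dual_def)
  have ah: "\<eta> ah = 0" using eta_dual_omega[OF nabla assms(7)] .
  note phi_a = phi_dual_theta[OF nabla assms(5,6)] phi_dual_theta_star[OF nabla assms(5,6)]
  let ?T0 = "family_torsion n M a as ah 0 (1 / (4 * real n)) 0 0"
  \<comment> \<open>\<open>q\<close> is linear in its coefficients; \<open>r\<close> is its deviation from the value with \<open>\<alpha>2 = 1 / (4 n)\<close>
      and the other coefficients \<open>0\<close>.\<close>
  define r where "r = q_field M a as ah \<alpha>1 (\<alpha>2 - 1 / (4 * real n)) \<alpha>3 \<alpha>4"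
  have r: "r \<in> VF M" "\<eta> r = 0" using V ah by (simp_all add: r_def q_field_def)
  have T0: "?T0 x y z = canonical_torsion n M a as ah x y z"
    if "x \<in> VF M" "y \<in> VF M" "z \<in> VF M" for x y z
    by (rule family_torsion_eq_canonical_torsion[OF that V phi_a ah])
  have T: "torsion3 M D x y z = ?T0 x y z + pi35 r x y z"
    if "x \<in> VF M" "y \<in> VF M" "z \<in> VF M" for x y z
    using assms(9) that family_torsion_eq[OF that V] by (simp add: r_def)
  have defect: "canonical_defect M (torsion3 M D) x y z = - (2 * pi35 r y z x)"
    if v: "x \<in> VF M" "y \<in> VF M" "z \<in> VF M" for x y z
  proof -
    have "canonical_defect M (torsion3 M D) x y z =
        canonical_defect M (\<lambda>x y z. canonical_torsion n M a as ah x y z + pi35 r x y z) x y z"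
      by (rule canonical_defect_cong[OF _ v]) (simp add: T T0)
    also have "\<dots> = - (2 * pi35 r y z x)"
      by (simp add: canonical_defect_add canonical_defect_canonical_torsion[OF v V phi_a ah]
          canonical_defect_pi35[OF v r])
    finally show ?thesis .
  qed
  have canonical: "phi_canonical M D \<longleftrightarrow> (\<forall>x\<in>VF M. \<forall>y\<in>VF M. \<forall>z\<in>VF M. pi35 r x y z = 0)"
  proof -
    have "- (2 * f) = 0 \<longleftrightarrow> f = 0" for f :: "'m \<Rightarrow> real" by (auto simp: fun_eq_iff)
    then show ?thesis using assms(8) defect unfolding phi_canonical_iff by simp metis
  qed
  have fam: "phi_canonical M D \<longleftrightarrow>
      (\<forall>x\<in>VF M. \<forall>y\<in>VF M. \<forall>z\<in>VF M. torsion3 M D x y z = ?T0 x y z)"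
    unfolding canonical by (simp add: T)
  have suff: "phi_canonical M D" if "\<alpha>1 = 0 \<and> \<alpha>3 = 0 \<and> \<alpha>4 = 0 \<and> \<alpha>2 = 1 / (4 * real n)"
    unfolding fam using assms(9) that by simp
  have nec: "\<alpha>1 = 0 \<and> \<alpha>3 = 0 \<and> \<alpha>4 = 0 \<and> \<alpha>2 = 1 / (4 * real n)"
    if "n \<ge> 2" "independent_parameters M a as ah" "phi_canonical M D"
  proof -
    have "r = 0" using pi35_eq_0_imp_eq_0[OF that(1) r] that(3) unfolding canonical by blast
    then have "(\<lambda>_. \<alpha>1) \<cdot> \<phi> (\<phi> as) + (\<lambda>_. - (\<alpha>2 - 1 / (4 * real n))) \<cdot> \<phi> (\<phi> a)
        + (\<lambda>_. - \<alpha>3) \<cdot> \<phi> ah + (\<lambda>_. \<alpha>4) \<cdot> ah = 0"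
      by (simp add: r_def q_field_def fun_eq_iff algebra_simps)
    then have "\<alpha>1 = 0 \<and> - (\<alpha>2 - 1 / (4 * real n)) = 0 \<and> - \<alpha>3 = 0 \<and> \<alpha>4 = 0"
      using that(2) unfolding independent_parameters_def by blast
    then show ?thesis by simp
  qed
  show ?thesis using suff nec fam T0 by auto
qed

end
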